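(* Let $p$ be a prime and $x\in\mathbb{Z}_p$. For every integer $m\ge0$, \[ B_m(1-x)=(-1)^m\int_{\mathbb{Z}_p}(x+y)^m\,d\mu_0(y)=\sum_{n=0}^{m}\widehat{D}_n(x)\,S_2(m,n). \] In particular, \[ B_m(1-x)=(-1)^mB_m(x)=\sum_{n=0}^{m}\widehat{D}_n(x)\,S_2(m,n). \]
   Context: The Bernoulli polynomials are defined by $\frac{t}{e^t-1}e^{xt}=\sum_{n\ge0}B_n(x)\frac{t^n}{n!}$. The Daehee polynomials of the second kind $\widehat{D}_n(x)$ are defined by $\frac{(1+t)\log(1+t)}{t}\cdot\frac{1}{(1+t)^x}=\sum_{n\ge0}\widehat{D}_n(x)\frac{t^n}{n!}$. The Stirling numbers of the second kind are defined by $(e^t-1)^m=m!\sum_{l\ge m}S_2(l,m)\frac{t^l}{l!}$. For a uniformly differentiable function $f:\mathbb{Z}_p\to\mathbb{C}_p$, the $p$-adic invariant (Volkenborn) integral is $\int_{\mathbb{Z}_p}f(y)\,d\mu_0(y)=\lim_{N\to\infty}\frac{1}{p^N}\sum_{y=0}^{p^N-1}f(y)$. *)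

theory Defs
  imports
    "HOL-Combinatorics.Stirling"
    "HOL-Algebra.Algebraic_Closure_Type"
    "Berlekamp_Zassenhaus.Finite_Field"
begin

section \<open>Fields of characteristic 0 with a non-archimedean absolute value\<close>

definition nonarch_abs :: "('a::field \<Rightarrow> real) \<Rightarrow> bool" where
  "nonarch_abs v \<longleftrightarrow> (\<forall>x. v x \<ge> 0) \<and> (\<forall>x. v x = 0 \<longleftrightarrow> x = 0) \<and>
     (\<forall>x y. v (x * y) = v x * v y) \<and> (\<forall>x y. v (x + y) \<le> max (v x) (v y))"

lemma nonarch_abs_triangle:
  assumes v: "nonarch_abs v"
  shows "v (x - y) \<le> v (x - z) + v (y - z)"
proof -
  have "v 1 = 1"
    using v unfolding nonarch_abs_def by (metis mult_cancel_right1 one_neq_zero)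
  hence "v (- 1) * v (- 1) = 1"
    using v unfolding nonarch_abs_def by (metis mult_minus1 minus_minus)
  hence "\<bar>v (- 1)\<bar> = 1"
    by (simp only: square_eq_1_iff) linarith
  moreover have "v (- 1) \<ge> 0"
    using v by (simp add: nonarch_abs_def)
  ultimately have "v (- 1) = 1"
    by linarith
  hence neg: "v (- w) = v w" for w
    using v unfolding nonarch_abs_def by (metis mult_minus1 mult_1)
  have "v (x - z + - (y - z)) \<le> max (v (x - z)) (v (y - z))"
    using v neg unfolding nonarch_abs_def by metis
  also have "x - z + - (y - z) = x - y"
    by simp
  finally have "v (x - y) \<le> max (v (x - z)) (v (y - z))" .
  moreover have "v (x - z) \<ge> 0" "v (y - z) \<ge> 0"
    using v by (simp_all add: nonarch_abs_def)
  ultimately show ?thesis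
    by linarith
qed

class nonarch_field = field_char_0 + metric_space +
  fixes vabs :: "'a \<Rightarrow> real"
  assumes dist_vabs: "dist x y = vabs (x - y)"
    and vabs_eq_0_iff [simp]: "vabs x = 0 \<longleftrightarrow> x = 0"
    and vabs_mult: "vabs (x * y) = vabs x * vabs y"
    and vabs_ultra: "vabs (x + y) \<le> max (vabs x) (vabs y)"
begin

lemma vabs_nonneg [simp]: "vabs x \<ge> 0"
  using dist_vabs[of x 0] zero_le_dist[of x 0] by simp

lemma vabs_0 [simp]: "vabs 0 = 0"
  by simp

lemma vabs_1 [simp]: "vabs 1 = 1"
  using vabs_mult[of 1 1] vabs_eq_0_iff[of 1] by simp

lemma vabs_pos: "x \<noteq> 0 \<Longrightarrow> vabs x > 0"
  using vabs_nonneg[of x] vabs_eq_0_iff[of x] by linarith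

lemma vabs_minus [simp]: "vabs (- x) = vabs x"
  using dist_commute[of x 0] by (simp add: dist_vabs)

lemma vabs_minus_commute: "vabs (x - y) = vabs (y - x)"
  using vabs_minus[of "x - y"] by (simp del: vabs_minus)

lemma vabs_diff_ultra: "vabs (x - y) \<le> max (vabs x) (vabs y)"
  using vabs_ultra[of x "- y"] by simp

lemma vabs_add_le: "vabs (x + y) \<le> vabs x + vabs y"
  using vabs_ultra[of x y] vabs_nonneg[of x] vabs_nonneg[of y] by linarith

lemma vabs_diff_le: "\<bar>vabs x - vabs y\<bar> \<le> vabs (x - y)"
  using vabs_add_le[of "x - y" y] vabs_add_le[of "y - x" x]
  by (simp add: vabs_minus_commute[of y x])

end

lemma vabs_inverse: "vabs (inverse x) = inverse (vabs x)"
  for x :: "'a::nonarch_field"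
proof (cases "x = 0")
  case False
  hence "vabs x * vabs (inverse x) = 1"
    using vabs_mult[of x "inverse x"] by simp
  thus ?thesis
    by (rule inverse_unique[symmetric])
qed simp

lemma vabs_divide: "vabs (x / y) = vabs x / vabs y"
  for x :: "'a::nonarch_field"
  by (simp add: divide_inverse vabs_mult vabs_inverse)

lemma vabs_power: "vabs (x ^ n) = vabs x ^ n"
  for x :: "'a::nonarch_field"
  by (induction n) (simp_all add: vabs_mult)

section \<open>Completion\<close>

definition null_seq :: "(nat \<Rightarrow> 'a::nonarch_field) \<Rightarrow> bool"
  where "null_seq u \<longleftrightarrow> (\<lambda>n. vabs (u n)) \<longlonglongrightarrow> 0"

definition cauchy_eq :: "(nat \<Rightarrow> 'a::nonarch_field) \<Rightarrow> (nat \<Rightarrow> 'a) \<Rightarrow> bool"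
  where "cauchy_eq u v \<longleftrightarrow> Cauchy u \<and> Cauchy v \<and> null_seq (\<lambda>n. u n - v n)"

lemma null_seq_le:
  assumes "v \<longlonglongrightarrow> 0" "\<And>n. vabs (u n) \<le> v n"
  shows "null_seq u"
  unfolding null_seq_def
  by (rule tendsto_sandwich[OF _ _ tendsto_const assms(1)]) (use assms(2) in auto)

lemma null_seq_zero [simp]: "null_seq (\<lambda>n. 0)"
  by (simp add: null_seq_def)

lemma null_seq_add: "null_seq u \<Longrightarrow> null_seq v \<Longrightarrow> null_seq (\<lambda>n. u n + v n)"
  by (rule null_seq_le[of "\<lambda>n. vabs (u n) + vabs (v n)"])
     (auto simp: null_seq_def vabs_add_le intro: tendsto_add_zero)

lemma null_seq_minus: "null_seq u \<Longrightarrow> null_seq (\<lambda>n. - u n)"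
  by (simp add: null_seq_def)

lemma null_seq_mult_bdd:
  assumes "null_seq u" "\<And>n. vabs (v n) \<le> B"
  shows "null_seq (\<lambda>n. u n * v n)"
proof (rule null_seq_le[of "\<lambda>n. vabs (u n) * B"])
  show "(\<lambda>n. vabs (u n) * B) \<longlonglongrightarrow> 0"
    using assms(1) by (auto simp: null_seq_def intro: tendsto_mult_left_zero)
qed (simp add: vabs_mult assms(2) mult_left_mono)

lemma Cauchy_vabs_def:
  "Cauchy u \<longleftrightarrow> (\<forall>e>0. \<exists>M. \<forall>m\<ge>M. \<forall>n\<ge>M. vabs (u m - u n) < e)"
  for u :: "nat \<Rightarrow> 'a::nonarch_field"
  by (simp add: Cauchy_def dist_vabs)

lemma CauchyI_vabs:
  fixes u :: "nat \<Rightarrow> 'a::nonarch_field"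
  assumes "\<And>e. e > 0 \<Longrightarrow> \<exists>M. \<forall>m\<ge>M. \<forall>n\<ge>M. vabs (u m - u n) < e"
  shows "Cauchy u"
  using assms by (simp add: Cauchy_vabs_def)

lemma CauchyD_vabs:
  fixes u :: "nat \<Rightarrow> 'a::nonarch_field"
  assumes "Cauchy u" "e > 0"
  obtains M where "\<And>m n. m \<ge> M \<Longrightarrow> n \<ge> M \<Longrightarrow> vabs (u m - u n) < e"
  using assms unfolding Cauchy_vabs_def by meson

lemma Cauchy_const_vabs: "Cauchy (\<lambda>n. c)"
  for c :: "'a::nonarch_field"
  by (simp add: Cauchy_vabs_def)

lemma Cauchy_vabs:
  fixes u :: "nat \<Rightarrow> 'a::nonarch_field"
  assumes "Cauchy u"
  shows "Cauchy (\<lambda>n. vabs (u n))"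
proof (rule metric_CauchyI)
  fix e :: real assume "e > 0"
  then obtain M where "\<And>m n. m \<ge> M \<Longrightarrow> n \<ge> M \<Longrightarrow> vabs (u m - u n) < e"
    using CauchyD_vabs[OF assms] by blast
  thus "\<exists>M. \<forall>m\<ge>M. \<forall>n\<ge>M. dist (vabs (u m)) (vabs (u n)) < e"
    by (metis dist_real_def order_le_less_trans vabs_diff_le)
qed

lemma Cauchy_vabs_limit: "Cauchy u \<Longrightarrow> (\<lambda>n. vabs (u n)) \<longlonglongrightarrow> lim (\<lambda>n. vabs (u n))"
  using Cauchy_vabs Cauchy_convergent convergent_LIMSEQ_iff by blast

lemma Cauchy_bdd:
  fixes u :: "nat \<Rightarrow> 'a::nonarch_field"
  assumes "Cauchy u"
  obtains B where "B > 0" "\<And>n. vabs (u n) \<le> B"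
proof -
  have "Bseq (\<lambda>n. vabs (u n))"
    using Cauchy_vabs[OF assms] by (rule Cauchy_Bseq)
  thus ?thesis
    using that by (auto simp: Bseq_def)
qed

lemma Cauchy_add_vabs:
  fixes u v :: "nat \<Rightarrow> 'a::nonarch_field"
  assumes "Cauchy u" "Cauchy v"
  shows "Cauchy (\<lambda>n. u n + v n)"
proof (rule CauchyI_vabs)
  fix e :: real assume e: "e > 0"
  obtain M1 where M1: "\<And>m n. m \<ge> M1 \<Longrightarrow> n \<ge> M1 \<Longrightarrow> vabs (u m - u n) < e"
    using CauchyD_vabs[OF assms(1) e] by blast
  obtain M2 where M2: "\<And>m n. m \<ge> M2 \<Longrightarrow> n \<ge> M2 \<Longrightarrow> vabs (v m - v n) < e"
    using CauchyD_vabs[OF assms(2) e] by blast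
  have "vabs (u m + v m - (u n + v n)) < e" if "m \<ge> max M1 M2" "n \<ge> max M1 M2" for m n
    using M1[of m n] M2[of m n] that vabs_ultra[of "u m - u n" "v m - v n"]
    by (simp add: algebra_simps)
  thus "\<exists>M. \<forall>m\<ge>M. \<forall>n\<ge>M. vabs (u m + v m - (u n + v n)) < e"
    by blast
qed

lemma Cauchy_minus_vabs:
  fixes u :: "nat \<Rightarrow> 'a::nonarch_field"
  assumes "Cauchy u"
  shows "Cauchy (\<lambda>n. - u n)"
proof -
  have "vabs (- a - - b) = vabs (a - b)" for a b :: 'a
    using vabs_minus[of "a - b"] by (simp del: vabs_minus add: algebra_simps)
  thus ?thesis
    using assms by (simp only: Cauchy_vabs_def)
qed

lemma Cauchy_mult_vabs:
  fixes u v :: "nat \<Rightarrow> 'a::nonarch_field"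
  assumes "Cauchy u" "Cauchy v"
  shows "Cauchy (\<lambda>n. u n * v n)"
proof (rule CauchyI_vabs)
  fix e :: real assume e: "e > 0"
  obtain B where B: "B > 0" "\<And>n. vabs (u n) \<le> B"
    using Cauchy_bdd[OF assms(1)] by blast
  obtain C where C: "C > 0" "\<And>n. vabs (v n) \<le> C"
    using Cauchy_bdd[OF assms(2)] by blast
  obtain M1 where M1: "\<And>m n. m \<ge> M1 \<Longrightarrow> n \<ge> M1 \<Longrightarrow> vabs (u m - u n) < e / C"
    using CauchyD_vabs[OF assms(1), of "e / C"] e C by auto
  obtain M2 where M2: "\<And>m n. m \<ge> M2 \<Longrightarrow> n \<ge> M2 \<Longrightarrow> vabs (v m - v n) < e / B"
    using CauchyD_vabs[OF assms(2), of "e / B"] e B by auto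
  have "vabs (u m * v m - u n * v n) < e" if mn: "m \<ge> max M1 M2" "n \<ge> max M1 M2" for m n
  proof -
    have "vabs (u m * (v m - v n)) \<le> B * vabs (v m - v n)"
      using B by (simp add: vabs_mult mult_right_mono)
    also have "\<dots> < e"
      using M2[of m n] mn B by (simp add: field_simps)
    finally have 1: "vabs (u m * (v m - v n)) < e" .
    have "vabs ((u m - u n) * v n) \<le> vabs (u m - u n) * C"
      using C by (simp add: vabs_mult mult_left_mono)
    also have "\<dots> < e"
      using M1[of m n] mn C by (simp add: field_simps)
    finally have 2: "vabs ((u m - u n) * v n) < e" .
    have "u m * v m - u n * v n = u m * (v m - v n) + (u m - u n) * v n"
      by (simp add: algebra_simps)
    thus ?thesis
      using 1 2 vabs_ultra[of "u m * (v m - v n)" "(u m - u n) * v n"] by simp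
  qed
  thus "\<exists>M. \<forall>m\<ge>M. \<forall>n\<ge>M. vabs (u m * v m - u n * v n) < e"
    by blast
qed

lemma not_null_seq_bound:
  fixes u :: "nat \<Rightarrow> 'a::nonarch_field"
  assumes "Cauchy u" "\<not> null_seq u"
  obtains r M where "r > 0" "\<And>n. n \<ge> M \<Longrightarrow> vabs (u n) > r"
proof -
  define l where "l = lim (\<lambda>n. vabs (u n))"
  have l: "(\<lambda>n. vabs (u n)) \<longlonglongrightarrow> l"
    unfolding l_def by (rule Cauchy_vabs_limit[OF assms(1)])
  have "l \<ge> 0"
    by (rule LIMSEQ_le_const[OF l]) auto
  moreover have "l \<noteq> 0"
    using assms(2) l by (auto simp: null_seq_def)
  ultimately have "l / 2 > 0" "l / 2 < l"
    by auto
  from order_tendstoD(1)[OF l this(2)] obtain M where "\<And>n. n \<ge> M \<Longrightarrow> vabs (u n) > l / 2"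
    by (auto simp: eventually_sequentially)
  with \<open>l / 2 > 0\<close> show ?thesis
    using that by blast
qed

lemma Cauchy_inverse_vabs:
  fixes u :: "nat \<Rightarrow> 'a::nonarch_field"
  assumes "Cauchy u" "\<not> null_seq u"
  shows "Cauchy (\<lambda>n. inverse (u n))"
proof (rule CauchyI_vabs)
  fix e :: real assume e: "e > 0"
  obtain r M where r: "r > 0" "\<And>n. n \<ge> M \<Longrightarrow> vabs (u n) > r"
    using not_null_seq_bound[OF assms] by blast
  obtain M1 where M1: "\<And>m n. m \<ge> M1 \<Longrightarrow> n \<ge> M1 \<Longrightarrow> vabs (u m - u n) < e * (r * r)"
    using CauchyD_vabs[OF assms(1), of "e * (r * r)"] e r by auto
  have "vabs (inverse (u m) - inverse (u n)) < e" if mn: "m \<ge> max M M1" "n \<ge> max M M1" for m n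
  proof -
    have gt: "vabs (u m) > r" "vabs (u n) > r"
      using r mn by auto
    hence nz: "u m \<noteq> 0" "u n \<noteq> 0"
      using r(1) by auto
    have "inverse (u m) - inverse (u n) = (u n - u m) / (u m * u n)"
      using nz by (simp add: field_simps)
    hence "vabs (inverse (u m) - inverse (u n)) = vabs (u m - u n) / (vabs (u m) * vabs (u n))"
      by (simp add: vabs_divide vabs_mult vabs_minus_commute)
    also have "\<dots> < e"
    proof -
      have "vabs (u m - u n) < e * (r * r)"
        using M1 mn by auto
      also have "\<dots> \<le> e * (vabs (u m) * vabs (u n))"
        using gt r e by (intro mult_left_mono mult_mono) auto
      finally show ?thesis
        using nz by (subst pos_divide_less_eq) (simp_all add: order_less_le)
    qed
    finally show ?thesis .
  qed
  thus "\<exists>M. \<forall>m\<ge>M. \<forall>n\<ge>M. vabs (inverse (u m) - inverse (u n)) < e"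
    by blast
qed

lemma cauchy_eq_refl: "Cauchy u \<Longrightarrow> cauchy_eq u u"
  by (simp add: cauchy_eq_def)

lemma cauchy_eq_sym: "cauchy_eq u v \<Longrightarrow> cauchy_eq v u"
  using null_seq_minus[of "\<lambda>n. u n - v n"] by (simp add: cauchy_eq_def)

lemma cauchy_eq_trans: "cauchy_eq u v \<Longrightarrow> cauchy_eq v w \<Longrightarrow> cauchy_eq u w"
  using null_seq_add[of "\<lambda>n. u n - v n" "\<lambda>n. v n - w n"] by (simp add: cauchy_eq_def)

lemma part_equivp_cauchy_eq: "part_equivp cauchy_eq"
proof (rule part_equivpI)
  show "\<exists>u. cauchy_eq u u"
    using cauchy_eq_refl[OF Cauchy_const_vabs] by blast
qed (auto intro: sympI transpI cauchy_eq_sym cauchy_eq_trans)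

quotient_type (overloaded) 'a completion = "nat \<Rightarrow> 'a::nonarch_field" / partial: cauchy_eq
  by (rule part_equivp_cauchy_eq)

lemma cauchy_eq_null: "cauchy_eq u v \<Longrightarrow> null_seq u \<longleftrightarrow> null_seq v"
  using null_seq_add[of "\<lambda>n. u n - v n" v] null_seq_add[of "\<lambda>n. v n - u n" u]
    null_seq_minus[of "\<lambda>n. u n - v n"]
  by (auto simp: cauchy_eq_def)

lemma cauchy_eq_add:
  assumes "cauchy_eq u u'" "cauchy_eq v v'"
  shows "cauchy_eq (\<lambda>n. u n + v n) (\<lambda>n. u' n + v' n)"
  using assms null_seq_add[of "\<lambda>n. u n - u' n" "\<lambda>n. v n - v' n"]
  by (auto simp: cauchy_eq_def Cauchy_add_vabs algebra_simps)

lemma cauchy_eq_minus: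
  assumes "cauchy_eq u u'"
  shows "cauchy_eq (\<lambda>n. - u n) (\<lambda>n. - u' n)"
  using assms null_seq_minus[of "\<lambda>n. u n - u' n"]
  by (auto simp: cauchy_eq_def Cauchy_minus_vabs algebra_simps)

lemma cauchy_eq_diff:
  assumes "cauchy_eq u u'" "cauchy_eq v v'"
  shows "cauchy_eq (\<lambda>n. u n - v n) (\<lambda>n. u' n - v' n)"
  using cauchy_eq_add[OF assms(1) cauchy_eq_minus[OF assms(2)]] by simp

lemma cauchy_eq_mult:
  assumes "cauchy_eq u u'" "cauchy_eq v v'"
  shows "cauchy_eq (\<lambda>n. u n * v n) (\<lambda>n. u' n * v' n)"
proof -
  obtain B where B: "\<And>n. vabs (v n) \<le> B"
    using Cauchy_bdd[of v] assms by (auto simp: cauchy_eq_def)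
  obtain C where C: "\<And>n. vabs (u' n) \<le> C"
    using Cauchy_bdd[of u'] assms by (auto simp: cauchy_eq_def)
  have "null_seq (\<lambda>n. (u n - u' n) * v n + (v n - v' n) * u' n)"
    using assms B C by (intro null_seq_add null_seq_mult_bdd[of _ v B] null_seq_mult_bdd[of _ u' C])
      (auto simp: cauchy_eq_def)
  also have "(\<lambda>n. (u n - u' n) * v n + (v n - v' n) * u' n) = (\<lambda>n. u n * v n - u' n * v' n)"
    by (simp add: algebra_simps)
  finally show ?thesis
    using assms by (auto simp: cauchy_eq_def Cauchy_mult_vabs)
qed

definition inverse_seq :: "(nat \<Rightarrow> 'a::nonarch_field) \<Rightarrow> nat \<Rightarrow> 'a"
  where "inverse_seq u = (if null_seq u then (\<lambda>n. 0) else (\<lambda>n. inverse (u n)))"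

lemma Cauchy_inverse_seq: "Cauchy u \<Longrightarrow> Cauchy (inverse_seq u)"
  by (simp add: inverse_seq_def Cauchy_const_vabs Cauchy_inverse_vabs)

lemma inverse_seq_right:
  assumes "Cauchy u" "\<not> null_seq u"
  shows "cauchy_eq (\<lambda>n. u n * inverse_seq u n) (\<lambda>n. 1)"
proof -
  obtain r M where r: "r > 0" "\<And>n. n \<ge> M \<Longrightarrow> vabs (u n) > r"
    using not_null_seq_bound[OF assms] by blast
  have "u n \<noteq> 0" if "n \<ge> M" for n
    using r(2)[OF that] r(1) by auto
  hence "\<forall>n\<ge>M. vabs (u n * inverse (u n) - 1) = 0"
    by simp
  hence "\<forall>\<^sub>F n in sequentially. vabs (u n * inverse (u n) - 1) = 0"
    unfolding eventually_sequentially by blast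
  hence "(\<lambda>n. vabs (u n * inverse (u n) - 1)) \<longlonglongrightarrow> 0"
    by (rule tendsto_eventually)
  hence "cauchy_eq (\<lambda>n. u n * inverse (u n)) (\<lambda>n. 1)"
    unfolding cauchy_eq_def null_seq_def
    by (intro conjI Cauchy_mult_vabs Cauchy_inverse_vabs assms Cauchy_const_vabs)
  thus ?thesis
    using assms(2) by (simp only: inverse_seq_def if_False)
qed

lemma cauchy_eq_inverse:
  assumes "cauchy_eq u v"
  shows "cauchy_eq (inverse_seq u) (inverse_seq v)"
proof (cases "null_seq u")
  case True
  thus ?thesis
    using cauchy_eq_null[OF assms] by (simp add: inverse_seq_def cauchy_eq_refl Cauchy_const_vabs)
next
  case False
  have C: "Cauchy u" "Cauchy v"
    using assms by (auto simp: cauchy_eq_def)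
  have F: "\<not> null_seq v"
    using False cauchy_eq_null[OF assms] by simp
  note rf = cauchy_eq_refl[OF Cauchy_inverse_seq[OF C(1)]] cauchy_eq_refl[OF Cauchy_inverse_seq[OF C(2)]]
  have 1: "cauchy_eq (\<lambda>n. (u n * inverse_seq u n) * inverse_seq v n) (\<lambda>n. 1 * inverse_seq v n)"
    by (rule cauchy_eq_mult[OF inverse_seq_right[OF C(1) False] rf(2)])
  have 2: "cauchy_eq (\<lambda>n. (u n * inverse_seq v n) * inverse_seq u n) (\<lambda>n. (v n * inverse_seq v n) * inverse_seq u n)"
    by (rule cauchy_eq_mult[OF cauchy_eq_mult[OF assms rf(2)] rf(1)])
  have 3: "cauchy_eq (\<lambda>n. (v n * inverse_seq v n) * inverse_seq u n) (\<lambda>n. 1 * inverse_seq u n)"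
    by (rule cauchy_eq_mult[OF inverse_seq_right[OF C(2) F] rf(1)])
  have "(\<lambda>n. (u n * inverse_seq u n) * inverse_seq v n) = (\<lambda>n. (u n * inverse_seq v n) * inverse_seq u n)"
    by (simp add: ac_simps)
  with 1 have "cauchy_eq (\<lambda>n. (u n * inverse_seq v n) * inverse_seq u n) (inverse_seq v)"
    by simp
  from cauchy_eq_trans[OF cauchy_eq_sym[OF cauchy_eq_trans[OF 2 3]] this] show ?thesis
    by simp
qed

lemma cauchy_eq_vabs:
  assumes "cauchy_eq u v"
  shows "lim (\<lambda>n. vabs (u n)) = lim (\<lambda>n. vabs (v n))"
proof -
  have "(\<lambda>n. vabs (u n) - vabs (v n)) \<longlonglongrightarrow> 0"
    by (rule tendsto_rabs_zero_cancel, rule tendsto_sandwich[OF _ _ tendsto_const,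
          where h = "\<lambda>n. vabs (u n - v n)"])
       (use assms in \<open>auto simp: cauchy_eq_def null_seq_def vabs_diff_le\<close>)
  moreover have "(\<lambda>n. vabs (u n) - vabs (v n)) \<longlonglongrightarrow> lim (\<lambda>n. vabs (u n)) - lim (\<lambda>n. vabs (v n))"
    using assms by (intro tendsto_diff Cauchy_vabs_limit) (auto simp: cauchy_eq_def)
  ultimately have "lim (\<lambda>n. vabs (u n)) - lim (\<lambda>n. vabs (v n)) = 0"
    using LIMSEQ_unique by blast
  thus ?thesis
    by simp
qed

instantiation completion :: (nonarch_field) field
begin

lift_definition zero_completion :: "'a completion" is "\<lambda>n. 0"
  by (simp add: cauchy_eq_refl Cauchy_const_vabs)
lift_definition one_completion :: "'a completion" is "\<lambda>n. 1"
  by (simp add: cauchy_eq_refl Cauchy_const_vabs)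
lift_definition plus_completion :: "'a completion \<Rightarrow> 'a completion \<Rightarrow> 'a completion"
  is "\<lambda>u v n. u n + v n" by (rule cauchy_eq_add)
lift_definition minus_completion :: "'a completion \<Rightarrow> 'a completion \<Rightarrow> 'a completion"
  is "\<lambda>u v n. u n - v n" by (rule cauchy_eq_diff)
lift_definition uminus_completion :: "'a completion \<Rightarrow> 'a completion"
  is "\<lambda>u n. - u n" by (rule cauchy_eq_minus)
lift_definition times_completion :: "'a completion \<Rightarrow> 'a completion \<Rightarrow> 'a completion"
  is "\<lambda>u v n. u n * v n" by (rule cauchy_eq_mult)
lift_definition inverse_completion :: "'a completion \<Rightarrow> 'a completion"
  is inverse_seq by (rule cauchy_eq_inverse)
definition divide_completion :: "'a completion \<Rightarrow> 'a completion \<Rightarrow> 'a completion"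
  where "divide_completion x y = x * inverse y"

instance
proof
  fix a b c :: "'a completion"
  note r = cauchy_eq_def[of u u for u]
  show "a * b * c = a * (b * c)"
    by transfer (auto simp: mult.assoc r intro!: Cauchy_mult_vabs)
  show "a * b = b * a"
    by transfer (auto simp: mult.commute r intro!: Cauchy_mult_vabs)
  show "1 * a = a"
    by transfer (auto simp: r)
  show "a + b + c = a + (b + c)"
    by transfer (auto simp: add.assoc r intro!: Cauchy_add_vabs)
  show "a + b = b + a"
    by transfer (auto simp: add.commute r intro!: Cauchy_add_vabs)
  show "0 + a = a"
    by transfer (auto simp: r)
  show "- a + a = 0"
    by transfer (auto simp: r Cauchy_const_vabs)
  show "a - b = a + - b"
  proof transfer
    fix u v :: "nat \<Rightarrow> 'a" assume "cauchy_eq u u" "cauchy_eq v v"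
    thus "cauchy_eq (\<lambda>n. u n - v n) (\<lambda>n. u n + - v n)"
      using cauchy_eq_diff[of u u v v] by simp
  qed
  show "(a + b) * c = a * c + b * c"
    by transfer (auto simp: distrib_right r intro!: Cauchy_mult_vabs Cauchy_add_vabs)
  show "(0 :: 'a completion) \<noteq> 1"
    by transfer (auto simp: cauchy_eq_def null_seq_def LIMSEQ_const_iff)
  show "a \<noteq> 0 \<Longrightarrow> inverse a * a = 1"
  proof transfer
    fix u :: "nat \<Rightarrow> 'a" assume u: "cauchy_eq u u" "\<not> cauchy_eq u (\<lambda>n. 0)"
    hence "Cauchy u" "\<not> null_seq u"
      by (auto simp: cauchy_eq_def Cauchy_const_vabs)
    thus "cauchy_eq (\<lambda>n. inverse_seq u n * u n) (\<lambda>n. 1)"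
      using inverse_seq_right[of u] by (simp add: mult.commute)
  qed
  show "a div b = a * inverse b"
    by (rule divide_completion_def)
  show "inverse (0 :: 'a completion) = 0"
    by transfer (simp add: inverse_seq_def cauchy_eq_refl Cauchy_const_vabs)
qed

end

lift_definition to_completion :: "'a::nonarch_field \<Rightarrow> 'a completion" is "\<lambda>x n. x"
  by (simp add: cauchy_eq_refl Cauchy_const_vabs)

lemma to_completion_0 [simp]: "to_completion 0 = 0"
  by transfer (simp add: cauchy_eq_refl Cauchy_const_vabs)

lemma to_completion_1 [simp]: "to_completion 1 = 1"
  by transfer (simp add: cauchy_eq_refl Cauchy_const_vabs)

lemma to_completion_add [simp]: "to_completion (x + y) = to_completion x + to_completion y"
  by transfer (simp add: cauchy_eq_refl Cauchy_const_vabs)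

lemma to_completion_mult [simp]: "to_completion (x * y) = to_completion x * to_completion y"
  by transfer (simp add: cauchy_eq_refl Cauchy_const_vabs)

lemma to_completion_minus [simp]: "to_completion (- x) = - to_completion x"
  by transfer (simp add: cauchy_eq_refl Cauchy_const_vabs)

lemma to_completion_diff [simp]: "to_completion (x - y) = to_completion x - to_completion y"
  by transfer (simp add: cauchy_eq_refl Cauchy_const_vabs)

lemma to_completion_of_nat [simp]: "to_completion (of_nat n) = of_nat n"
  by (induction n) simp_all

lemma to_completion_eq_iff [simp]: "to_completion x = to_completion y \<longleftrightarrow> x = y"
  by transfer (auto simp: cauchy_eq_def null_seq_def LIMSEQ_const_iff Cauchy_const_vabs)

instance completion :: (nonarch_field) field_char_0
proof
  show "inj (of_nat :: nat \<Rightarrow> 'a completion)"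
    by (rule injI) (metis of_nat_eq_iff to_completion_eq_iff to_completion_of_nat)
qed

instantiation completion :: (nonarch_field) nonarch_field
begin

lift_definition vabs_completion :: "'a completion \<Rightarrow> real" is "\<lambda>u. lim (\<lambda>n. vabs (u n))"
  by (rule cauchy_eq_vabs)

definition dist_completion :: "'a completion \<Rightarrow> 'a completion \<Rightarrow> real"
  where "dist_completion x y = vabs (x - y)"

definition uniformity_completion :: "('a completion \<times> 'a completion) filter"
  where "uniformity_completion = (INF e\<in>{0 <..}. principal {(x, y). dist x y < e})"

definition open_completion :: "'a completion set \<Rightarrow> bool"
  where "open_completion U \<longleftrightarrow> (\<forall>x\<in>U. eventually (\<lambda>(x', y). x' = x \<longrightarrow> y \<in> U) uniformity)"

instance
proof
  fix x y z :: "'a completion"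
  have eq0: "vabs x = 0 \<longleftrightarrow> x = 0" for x :: "'a completion"
  proof transfer
    fix u :: "nat \<Rightarrow> 'a" assume "cauchy_eq u u"
    hence "Cauchy u"
      by (simp add: cauchy_eq_def)
    from Cauchy_vabs_limit[OF this] have "lim (\<lambda>n. vabs (u n)) = 0 \<longleftrightarrow> null_seq u"
      unfolding null_seq_def by (metis LIMSEQ_unique)
    with \<open>Cauchy u\<close> show "(lim (\<lambda>n. vabs (u n)) = 0) = cauchy_eq u (\<lambda>n. 0)"
      by (simp add: cauchy_eq_def Cauchy_const_vabs)
  qed
  have mult: "vabs (x * y) = vabs x * vabs y" for x y :: "'a completion"
  proof transfer
    fix u v :: "nat \<Rightarrow> 'a" assume "cauchy_eq u u" "cauchy_eq v v"
    hence "(\<lambda>n. vabs (u n * v n)) \<longlonglongrightarrow> lim (\<lambda>n. vabs (u n)) * lim (\<lambda>n. vabs (v n))"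
      unfolding vabs_mult by (intro tendsto_mult Cauchy_vabs_limit) (auto simp: cauchy_eq_def)
    thus "lim (\<lambda>n. vabs (u n * v n)) = lim (\<lambda>n. vabs (u n)) * lim (\<lambda>n. vabs (v n))"
      by (rule limI)
  qed
  have ultra: "vabs (x + y) \<le> max (vabs x) (vabs y)" for x y :: "'a completion"
  proof transfer
    fix u v :: "nat \<Rightarrow> 'a" assume "cauchy_eq u u" "cauchy_eq v v"
    hence C: "Cauchy u" "Cauchy v"
      by (auto simp: cauchy_eq_def)
    show "lim (\<lambda>n. vabs (u n + v n)) \<le> max (lim (\<lambda>n. vabs (u n))) (lim (\<lambda>n. vabs (v n)))"
      by (rule LIMSEQ_le[OF Cauchy_vabs_limit[OF Cauchy_add_vabs[OF C]]
            tendsto_max[OF Cauchy_vabs_limit[OF C(1)] Cauchy_vabs_limit[OF C(2)]]])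
         (simp add: vabs_ultra)
  qed
  have nonneg: "vabs x \<ge> 0" for x :: "'a completion"
  proof transfer
    fix u :: "nat \<Rightarrow> 'a" assume "cauchy_eq u u"
    thus "lim (\<lambda>n. vabs (u n)) \<ge> 0"
      by (intro LIMSEQ_le_const[OF Cauchy_vabs_limit]) (auto simp: cauchy_eq_def)
  qed
  have v: "nonarch_abs (vabs :: 'a completion \<Rightarrow> real)"
    unfolding nonarch_abs_def using nonneg eq0 mult ultra by blast
  show "vabs x = 0 \<longleftrightarrow> x = 0" "vabs (x * y) = vabs x * vabs y" "vabs (x + y) \<le> max (vabs x) (vabs y)"
    by (rule eq0 mult ultra)+
  show "dist x y = 0 \<longleftrightarrow> x = y" "dist x y \<le> dist x z + dist y z"
    using eq0 nonarch_abs_triangle[OF v] by (simp_all add: dist_completion_def)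
qed (fact dist_completion_def uniformity_completion_def open_completion_def)+

end

lemma vabs_to_completion [simp]: "vabs (to_completion x) = vabs x"
  by transfer simp

lemma Cauchy_to_completion_tendsto:
  assumes C: "Cauchy u" shows "(\<lambda>n. to_completion (u n)) \<longlonglongrightarrow> abs_completion u"
proof (rule metric_LIMSEQ_I)
  fix e :: real assume e: "0 < e"
  obtain M where M: "\<And>m n. m \<ge> M \<Longrightarrow> n \<ge> M \<Longrightarrow> vabs (u m - u n) < e / 2"
    using CauchyD_vabs[OF C, of "e / 2"] e by auto
  have "dist (to_completion (u n)) (abs_completion u) < e" if "n \<ge> M" for n
  proof -
    have cx: "cauchy_eq u u" "cauchy_eq (\<lambda>k. u n) (\<lambda>k. u n)"
      using C by (simp_all add: cauchy_eq_refl Cauchy_const_vabs)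
    have cd: "cauchy_eq (\<lambda>k. u n - u k) (\<lambda>k. u n - u k)"
      by (rule cauchy_eq_diff[OF cx(2,1)])
    have "dist (to_completion (u n)) (abs_completion u) = lim (\<lambda>k. vabs (u n - u k))"
      using cx cd by (simp add: dist_vabs to_completion.abs_eq minus_completion.abs_eq vabs_completion.abs_eq)
    also have "\<dots> \<le> e / 2"
    proof -
      have "Cauchy (\<lambda>k. u n - u k)"
        using cd by (simp add: cauchy_eq_def)
      from Cauchy_vabs_limit[OF this] show ?thesis
        by (rule LIMSEQ_le_const2) (use M that in \<open>auto intro!: exI[of _ M] less_imp_le\<close>)
    qed
    finally show ?thesis
      using e by simp
  qed
  thus "\<exists>no. \<forall>n\<ge>no. dist (to_completion (u n)) (abs_completion u) < e"
    by blast
qed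

lemma completion_dense:
  fixes z :: "'a::nonarch_field completion"
  assumes "e > 0"
  obtains x where "vabs (z - to_completion x) < e"
proof -
  have "\<exists>u. z = abs_completion u \<and> cauchy_eq u u"
    by (induction z rule: completion.abs_induct) blast
  then obtain u where u: "z = abs_completion u" "cauchy_eq u u"
    by blast
  from u(2) have "(\<lambda>n. to_completion (u n)) \<longlonglongrightarrow> z"
    unfolding u(1) by (intro Cauchy_to_completion_tendsto) (simp add: cauchy_eq_def)
  from metric_LIMSEQ_D[OF this assms] obtain n where "dist (to_completion (u n)) z < e"
    by blast
  thus ?thesis
    by (intro that[of "u n"]) (simp add: dist_vabs vabs_minus_commute)
qed

instance completion :: (nonarch_field) complete_space
proof
  fix w :: "nat \<Rightarrow> 'a completion" assume w: "Cauchy w"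
  have "\<exists>x. vabs (w n - to_completion x) < 1 / real (Suc n)" for n
    by (rule completion_dense[of "1 / real (Suc n)" "w n"]) auto
  then obtain u where u: "\<And>n. dist (w n) (to_completion (u n)) < 1 / real (Suc n)"
    unfolding dist_vabs by metis
  have D: "(\<lambda>n. dist (w n) (to_completion (u n))) \<longlonglongrightarrow> 0"
    by (rule tendsto_sandwich[OF _ _ tendsto_const LIMSEQ_inverse_real_of_nat])
       (use u in \<open>auto simp: inverse_eq_divide intro!: always_eventually less_imp_le\<close>)
  have "Cauchy u"
  proof (rule CauchyI_vabs)
    fix e :: real assume e: "e > 0"
    obtain M1 where M1: "\<And>m n. m \<ge> M1 \<Longrightarrow> n \<ge> M1 \<Longrightarrow> dist (w m) (w n) < e / 3"
      using metric_CauchyD[OF w, of "e / 3"] e by auto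
    obtain M2 where M2: "\<And>n. n \<ge> M2 \<Longrightarrow> dist (w n) (to_completion (u n)) < e / 3"
      using order_tendstoD(2)[OF D, of "e / 3"] e by (auto simp: eventually_sequentially)
    have "vabs (u m - u n) < e" if "m \<ge> max M1 M2" "n \<ge> max M1 M2" for m n
    proof -
      have "vabs (u m - u n) = dist (to_completion (u m)) (to_completion (u n))"
        by (simp add: dist_vabs flip: to_completion_diff)
      also have "\<dots> \<le> dist (to_completion (u m)) (w m) + dist (w m) (w n) + dist (w n) (to_completion (u n))"
        using dist_triangle[of "to_completion (u m)" "to_completion (u n)" "w m"]
          dist_triangle[of "w m" "to_completion (u n)" "w n"] by simp
      also have "\<dots> < e"
        using M1[of m n] M2[of m] M2[of n] that by (simp add: dist_commute)
      finally show ?thesis .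
    qed
    thus "\<exists>M. \<forall>m\<ge>M. \<forall>n\<ge>M. vabs (u m - u n) < e"
      by blast
  qed
  hence L: "(\<lambda>n. to_completion (u n)) \<longlonglongrightarrow> abs_completion u"
    by (rule Cauchy_to_completion_tendsto)
  have "w \<longlonglongrightarrow> abs_completion u"
  proof (rule metric_LIMSEQ_I)
    fix e :: real assume e: "e > 0"
    have "\<forall>\<^sub>F n in sequentially. dist (w n) (to_completion (u n)) < e / 2"
      using order_tendstoD(2)[OF D, of "e / 2"] e by auto
    moreover have "\<forall>\<^sub>F n in sequentially. dist (to_completion (u n)) (abs_completion u) < e / 2"
      using tendstoD[OF L, of "e / 2"] e by auto
    ultimately have "\<forall>\<^sub>F n in sequentially. dist (w n) (abs_completion u) < e"
    proof eventually_elim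
      case (elim n)
      thus ?case
        using dist_triangle[of "w n" "abs_completion u" "to_completion (u n)"] by simp
    qed
    thus "\<exists>no. \<forall>n\<ge>no. dist (w n) (abs_completion u) < e"
      by (simp add: eventually_sequentially)
  qed
  thus "convergent w"
    by (auto simp: convergent_def)
qed

section \<open>The algebraic closure\<close>

text \<open>
  A subring of the algebraic closure that meets the base field exactly in its valuation ring.
\<close>

definition extends_ball :: "'a::nonarch_field alg_closure set \<Rightarrow> bool" where
  "extends_ball A \<longleftrightarrow> (\<forall>x\<in>A. \<forall>y\<in>A. x + y \<in> A \<and> x * y \<in> A) \<and> (\<forall>c. to_ac c \<in> A \<longleftrightarrow> vabs c \<le> 1)"

lemma ex_maximal_extends_ball:
  "\<exists>A :: 'a::nonarch_field alg_closure set. extends_ball A \<and> (\<forall>B. extends_ball B \<longrightarrow> A \<subseteq> B \<longrightarrow> B = A)"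
proof -
  have "extends_ball (to_ac ` {c :: 'a. vabs c \<le> 1})"
    unfolding extends_ball_def
  proof (intro conjI ballI allI)
    fix x y :: "'a alg_closure"
    assume "x \<in> to_ac ` {c. vabs c \<le> 1}" "y \<in> to_ac ` {c. vabs c \<le> 1}"
    then obtain c d where cd: "x = to_ac c" "y = to_ac d" "vabs c \<le> 1" "vabs d \<le> 1"
      by blast
    have "vabs (c + d) \<le> 1" "vabs (c * d) \<le> 1"
      using vabs_ultra[of c d] cd by (auto simp: vabs_mult mult_le_one)
    thus "x + y \<in> to_ac ` {c. vabs c \<le> 1}" "x * y \<in> to_ac ` {c. vabs c \<le> 1}"
      unfolding cd by (metis (mono_tags) imageI mem_Collect_eq to_ac_add to_ac_mult)+
  qed auto
  hence ne: "{A :: 'a alg_closure set. extends_ball A} \<noteq> {}"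
    by blast
  have "\<exists>M\<in>{A :: 'a alg_closure set. extends_ball A}.
      \<forall>B\<in>{A :: 'a alg_closure set. extends_ball A}. M \<subseteq> B \<longrightarrow> B = M"
  proof (rule subset_Zorn_nonempty[OF ne])
    fix \<C> :: "'a alg_closure set set"
    assume \<C>: "\<C> \<noteq> {}" "subset.chain {A. extends_ball A} \<C>"
    have eb: "extends_ball A" if "A \<in> \<C>" for A
      using \<C>(2) that by (auto simp: subset.chain_def)
    have ch: "A \<subseteq> B \<or> B \<subseteq> A" if "A \<in> \<C>" "B \<in> \<C>" for A B
      using \<C>(2) that by (auto simp: subset.chain_def)
    have "extends_ball (\<Union>\<C>)"
      unfolding extends_ball_def
    proof (intro conjI ballI allI)
      fix x y assume "x \<in> \<Union>\<C>" "y \<in> \<Union>\<C>"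
      then obtain A where "A \<in> \<C>" "x \<in> A" "y \<in> A"
        using ch by blast
      thus "x + y \<in> \<Union>\<C>" "x * y \<in> \<Union>\<C>"
        using eb by (auto simp: extends_ball_def)
    next
      fix c :: 'a
      show "to_ac c \<in> \<Union>\<C> \<longleftrightarrow> vabs c \<le> 1"
        using \<C>(1) eb by (auto simp: extends_ball_def)
    qed
    thus "\<Union>\<C> \<in> {A. extends_ball A}"
      by simp
  qed
  thus ?thesis
    by blast
qed

locale maximal_extends_ball =
  fixes A :: "'a::nonarch_field alg_closure set"
  assumes ball: "extends_ball A"
    and max: "\<And>B. extends_ball B \<Longrightarrow> A \<subseteq> B \<Longrightarrow> B = A"
begin

lemma add: "x \<in> A \<Longrightarrow> y \<in> A \<Longrightarrow> x + y \<in> A"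
  and mult: "x \<in> A \<Longrightarrow> y \<in> A \<Longrightarrow> x * y \<in> A"
  and base_iff: "to_ac c \<in> A \<longleftrightarrow> vabs c \<le> 1"
  using ball by (auto simp: extends_ball_def)

lemma one: "1 \<in> A" and zero: "0 \<in> A" and m1: "- 1 \<in> A"
  using base_iff[of 1] base_iff[of 0] base_iff[of "- 1"] by auto

lemma neg: "x \<in> A \<Longrightarrow> - x \<in> A"
  using mult[OF m1, of x] by simp

lemma pow: "x \<in> A \<Longrightarrow> x ^ n \<in> A"
  by (induction n) (auto intro: one mult)

lemma sum: "(\<And>i. i \<in> J \<Longrightarrow> f i \<in> A) \<Longrightarrow> sum f J \<in> A"
  by (induction J rule: infinite_finite_induct) (auto intro: zero add)

definition I where "I = {to_ac c * b | c b. vabs c < 1 \<and> b \<in> A}"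

lemma I_subset: "x \<in> I \<Longrightarrow> x \<in> A"
  by (auto simp: I_def intro!: mult simp: base_iff)

lemma I_mult: "x \<in> I \<Longrightarrow> y \<in> A \<Longrightarrow> x * y \<in> I"
  unfolding I_def using mult by (force simp: mult.assoc)

lemma I_zero: "0 \<in> I"
  unfolding I_def using zero by (intro CollectI exI[of _ 0]) auto

lemma I_neg: "x \<in> I \<Longrightarrow> - x \<in> I"
  using I_mult[OF _ m1, of x] by simp

lemma I_add_aux:
  assumes "vabs c < 1" "b \<in> A" "e \<in> A" "vabs d \<le> vabs c"
  shows "to_ac c * b + to_ac d * e \<in> I"
proof (cases "c = 0")
  case True
  hence "vabs d = 0"
    using assms(4) vabs_nonneg[of d] by (intro order_antisym) simp_all
  thus ?thesis
    using True I_zero by simp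
next
  case False
  hence "to_ac c * to_ac (d / c) = to_ac d"
    by simp
  hence "to_ac c * b + to_ac d * e = to_ac c * (b + to_ac (d / c) * e)"
    by (metis distrib_left mult.assoc)
  moreover have "vabs (d / c) \<le> 1"
    using assms(4) vabs_pos[OF False] by (simp add: vabs_divide)
  hence "b + to_ac (d / c) * e \<in> A"
    using assms by (intro add mult) (simp_all only: base_iff)
  ultimately show ?thesis
    using assms(1) unfolding I_def by blast
qed

lemma I_add: "x \<in> I \<Longrightarrow> y \<in> I \<Longrightarrow> x + y \<in> I"
proof -
  assume "x \<in> I" "y \<in> I"
  then obtain c b d e where *: "x = to_ac c * b" "y = to_ac d * e" "vabs c < 1" "vabs d < 1" "b \<in> A" "e \<in> A"
    by (auto simp: I_def)
  show "x + y \<in> I"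
  proof (cases "vabs d \<le> vabs c")
    case True
    thus ?thesis
      using I_add_aux[of c b e d] * by simp
  next
    case False
    thus ?thesis
      using I_add_aux[of d e b c] * by (simp add: add.commute)
  qed
qed

lemma I_sum: "(\<And>i. i \<in> J \<Longrightarrow> f i \<in> I) \<Longrightarrow> sum f J \<in> I"
  by (induction J rule: infinite_finite_induct) (auto intro: I_zero I_add)

lemma one_notin_I: "1 \<notin> I"
proof
  assume "1 \<in> I"
  then obtain c b where *: "1 = to_ac c * b" "vabs c < 1" "b \<in> A"
    by (auto simp: I_def)
  hence c: "c \<noteq> 0"
    by auto
  hence "b = to_ac (inverse c)"
    using *(1) by (simp add: field_simps)
  hence "vabs (inverse c) \<le> 1"
    using *(3) base_iff by blast
  moreover have "vabs c > 0"
    using c vabs_nonneg[of c] vabs_eq_0_iff[of c] by linarith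
  ultimately show False
    using * by (simp add: vabs_inverse inverse_le_1_iff)
qed

lemma unit_ne: "u \<in> I \<Longrightarrow> 1 + u \<noteq> 0"
  using one_notin_I I_neg[of u] by (metis add_eq_0_iff minus_minus)

text \<open>Localising at the elements congruent to 1 gives nothing new.\<close>

lemma unit_inverse:
  assumes "u \<in> I" shows "inverse (1 + u) \<in> A"
proof -
  define B where "B = {a / (1 + u) | a u. a \<in> A \<and> u \<in> I}"
  have AB: "A \<subseteq> B"
  proof
    fix x assume "x \<in> A"
    hence "x = x / (1 + 0) \<and> x \<in> A \<and> 0 \<in> I"
      using I_zero by simp
    thus "x \<in> B"
      unfolding B_def by blast
  qed
  have "extends_ball B"
    unfolding extends_ball_def
  proof (intro conjI ballI allI)
    fix x y assume "x \<in> B" "y \<in> B"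
    then obtain a u b v where *: "x = a / (1 + u)" "y = b / (1 + v)" "a \<in> A" "b \<in> A" "u \<in> I" "v \<in> I"
      by (auto simp: B_def)
    have uv: "u + v + u * v \<in> I"
      using * by (intro I_add I_mult) (auto dest: I_subset)
    have eq: "1 + (u + v + u * v) = (1 + u) * (1 + v)"
      by (simp add: algebra_simps)
    have nz: "1 + u \<noteq> 0" "1 + v \<noteq> 0"
      using * unit_ne by auto
    have "x + y = (a * (1 + v) + b * (1 + u)) / (1 + (u + v + u * v))"
      unfolding eq using nz by (simp add: * add_frac_eq)
    moreover have "a * (1 + v) + b * (1 + u) \<in> A"
      using * one by (intro add mult) (auto dest: I_subset)
    ultimately show "x + y \<in> B"
      using uv unfolding B_def by blast
    have "x * y = (a * b) / (1 + (u + v + u * v))"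
      unfolding eq using nz by (simp add: *)
    thus "x * y \<in> B"
      using uv mult[of a b] * unfolding B_def by blast
  next
    fix c :: 'a
    show "to_ac c \<in> B \<longleftrightarrow> vabs c \<le> 1"
    proof
      assume "vabs c \<le> 1"
      thus "to_ac c \<in> B"
        using AB base_iff by blast
    next
      assume "to_ac c \<in> B"
      then obtain a u where *: "to_ac c = a / (1 + u)" "a \<in> A" "u \<in> I"
        by (auto simp: B_def)
      show "vabs c \<le> 1"
      proof (rule ccontr)
        assume c: "\<not> vabs c \<le> 1"
        hence "c \<noteq> 0"
          by auto
        hence "1 = to_ac (inverse c) * a + - u"
          using *(1) unit_ne[OF *(3)] by (simp add: field_simps)
        moreover have "vabs (inverse c) < 1"
          using c by (simp add: vabs_inverse inverse_less_1_iff)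
        hence "to_ac (inverse c) * a \<in> I"
          using *(2) unfolding I_def by blast
        ultimately have "1 \<in> I"
          using I_add I_neg *(3) by metis
        thus False
          using one_notin_I by blast
      qed
    qed
  qed
  hence "B = A"
    using max AB by blast
  moreover have "inverse (1 + u) = 1 / (1 + u)"
    by (simp add: inverse_eq_divide)
  hence "inverse (1 + u) \<in> B"
    using one assms unfolding B_def by blast
  ultimately show ?thesis
    by simp
qed

lemma no_two_relations:
  assumes "x \<noteq> 0" "degree q + degree r = N"
    and "\<And>i. coeff q i \<in> I" "poly q x = 1" "\<And>i. coeff r i \<in> I" "poly r (inverse x) = 1"
  shows False
  using assms
proof (induction N arbitrary: x q r rule: less_induct)
  case (less N)
  have step: False
    if x: "x \<noteq> 0" and N: "degree q + degree r = N" and le: "degree r \<le> degree q"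
      and q: "\<And>i. coeff q i \<in> I" "poly q x = 1" and r: "\<And>i. coeff r i \<in> I" "poly r (inverse x) = 1"
    for x :: "'a alg_closure" and q r
  proof -
    define n where "n = degree q"
    define m where "m = degree r"
    define s where "s = (\<Sum>i\<in>{1..m}. monom (coeff r i) (n - i))"
    define w where "w = inverse (1 + - coeff r 0)"
    have w: "w \<in> A"
      unfolding w_def by (rule unit_inverse[OF I_neg[OF r(1)]])
    have nz: "1 + - coeff r 0 \<noteq> 0"
      by (rule unit_ne[OF I_neg[OF r(1)]])
    have n: "n > 0"
    proof (rule ccontr)
      assume "\<not> n > 0"
      hence "poly q x = coeff q 0"
        unfolding n_def by (metis degree_eq_zeroE gr0I coeff_pCons_0 poly_pCons mult_zero_right add.right_neutral poly_0)
      thus False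
        using q one_notin_I by metis
    qed
    have mn: "m \<le> n"
      using le by (simp add: n_def m_def)
    have "poly s x = (\<Sum>i\<in>{1..m}. coeff r i * x ^ (n - i))"
      by (simp add: s_def poly_sum poly_monom)
    also have "\<dots> = (\<Sum>i\<in>{1..m}. x ^ n * (coeff r i * inverse x ^ i))"
    proof (rule sum.cong)
      fix i assume "i \<in> {1..m}"
      hence "x ^ n = x ^ (n - i) * x ^ i"
        using mn by (simp flip: power_add)
      thus "coeff r i * x ^ (n - i) = x ^ n * (coeff r i * inverse x ^ i)"
        using x by (simp add: field_simps)
    qed simp
    also have "\<dots> = x ^ n * (poly r (inverse x) - coeff r 0)"
    proof -
      have "poly r (inverse x) = (\<Sum>i\<le>m. coeff r i * inverse x ^ i)"
        by (simp add: poly_altdef m_def)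
      also have "{..m} = insert 0 {1..m}"
        by auto
      finally show ?thesis
        by (simp add: sum_distrib_left)
    qed
    also have "\<dots> = x ^ n * (1 + - coeff r 0)"
      by (simp add: r)
    finally have s: "x ^ n = w * poly s x"
      using nz by (simp add: w_def field_simps)
    define q' where "q' = q - monom (coeff q n) n + smult (coeff q n * w) s"
    have "poly q' x = 1"
      using s q(2) by (simp add: q'_def poly_monom)
    moreover have cs: "coeff s i \<in> I" for i
      unfolding s_def coeff_sum by (intro I_sum) (auto simp: r I_zero)
    have "coeff q' i \<in> I" for i
    proof -
      have "coeff q i - coeff (monom (coeff q n) n) i \<in> I"
        using q(1) I_zero by (auto simp: coeff_monom)
      thus ?thesis
        unfolding q'_def coeff_add coeff_diff coeff_smult
        by (intro I_add I_mult w q(1)) (use cs I_subset in auto)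
    qed
    moreover have "degree q' < n"
    proof -
      have "degree q' \<le> n - 1"
      proof (rule degree_le, intro allI impI)
        fix i assume i: "i > n - 1"
        have "coeff q i - coeff (monom (coeff q n) n) i = 0"
          using i n coeff_eq_0[of q i] by (cases "i = n") (auto simp: n_def)
        moreover have "coeff s i = 0"
          unfolding s_def coeff_sum using i n by (intro sum.neutral) auto
        ultimately show "coeff q' i = 0"
          by (simp add: q'_def)
      qed
      thus ?thesis
        using n by linarith
    qed
    ultimately show False
      using less.IH[of "degree q' + degree r" x q' r] x N r by (auto simp: n_def)
  qed
  show False
  proof (cases "degree r \<le> degree q")
    case True
    thus ?thesis
      using step[of x q r] less.prems by blast
  next
    case False
    thus ?thesis
      using step[of "inverse x" r q] less.prems by (simp add: add.commute)
  qed
qed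

lemma relation:
  assumes "x \<notin> A"
  obtains q where "\<And>i. coeff q i \<in> I" "poly q x = 1"
proof -
  define B where "B = {poly p x | p. \<forall>i. coeff p i \<in> A}"
  have AB: "A \<subseteq> B"
  proof
    fix a assume "a \<in> A"
    hence "a = poly [:a:] x \<and> (\<forall>i. coeff [:a:] i \<in> A)"
      using zero by (auto simp: coeff_pCons split: nat.split)
    thus "a \<in> B"
      unfolding B_def by blast
  qed
  have "x = poly [:0, 1:] x \<and> (\<forall>i. coeff [:0, 1 :: 'a alg_closure:] i \<in> A)"
    using zero one by (auto simp: coeff_pCons split: nat.split)
  hence "x \<in> B"
    unfolding B_def by blast
  hence "B \<noteq> A"
    using assms by blast
  hence "\<not> extends_ball B"
    using max AB by blast
  moreover have "y + z \<in> B \<and> y * z \<in> B" if yz: "y \<in> B" "z \<in> B" for y z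
  proof -
    obtain p q where pq: "y = poly p x" "z = poly q x" "\<And>i. coeff p i \<in> A" "\<And>i. coeff q i \<in> A"
      using yz unfolding B_def by blast
    have "coeff (p + q) i \<in> A" "coeff (p * q) i \<in> A" for i
      by (auto simp: coeff_mult intro!: add mult sum pq)
    moreover have "y + z = poly (p + q) x" "y * z = poly (p * q) x"
      by (simp_all add: pq)
    ultimately show ?thesis
      unfolding B_def by blast
  qed
  moreover have "to_ac c \<in> B" if "vabs c \<le> 1" for c
    using that base_iff AB by blast
  ultimately obtain c where c: "vabs c > 1" "to_ac c \<in> B"
    unfolding extends_ball_def by (metis not_le)
  then obtain p where p: "to_ac c = poly p x" "\<And>i. coeff p i \<in> A"
    unfolding B_def by blast
  show ?thesis
  proof (rule that[of "smult (to_ac (inverse c)) p"])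
    have "vabs (inverse c) < 1"
      using c by (simp add: vabs_inverse inverse_less_1_iff)
    thus "coeff (smult (to_ac (inverse c)) p) i \<in> I" for i
      unfolding I_def coeff_smult using p(2) by blast
    show "poly (smult (to_ac (inverse c)) p) x = 1"
      using c(1) by (auto simp flip: p(1) intro!: left_inverse)
  qed
qed

lemma valuation_ring: "x \<in> A \<or> inverse x \<in> A"
proof (rule ccontr)
  assume *: "\<not> (x \<in> A \<or> inverse x \<in> A)"
  obtain q where q: "\<And>i. coeff q i \<in> I" "poly q x = 1"
    using relation[of x] * by blast
  obtain r where r: "\<And>i. coeff r i \<in> I" "poly r (inverse x) = 1"
    using relation[of "inverse x"] * by blast
  have "x \<noteq> 0"
    using * zero by auto
  thus False
    using no_two_relations[OF _ refl q r] by blast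
qed

definition M where "M = {x \<in> A. x = 0 \<or> inverse x \<notin> A}"

lemma M_add:
  assumes "x \<in> M" "y \<in> M"
  shows "x + y \<in> M"
proof (cases "x = 0 \<or> y = 0 \<or> x + y = 0")
  case True
  thus ?thesis
    using assms zero by (auto simp: M_def)
next
  case nz: False
  have "inverse (x + y) \<notin> A"
  proof
    assume *: "inverse (x + y) \<in> A"
    show False
    proof (cases "x / y \<in> A")
      case True
      have "inverse y = (1 + x / y) * inverse (x + y)"
        using nz by (simp add: field_simps)
      moreover have "(1 + x / y) * inverse (x + y) \<in> A"
        by (intro mult add one True *)
      ultimately show False
        using nz assms by (simp add: M_def)
    next
      case False
      hence y: "y / x \<in> A"
        using valuation_ring[of "x / y"] by simp
      have "inverse x = (1 + y / x) * inverse (x + y)"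
        using nz by (simp add: field_simps)
      moreover have "(1 + y / x) * inverse (x + y) \<in> A"
        by (intro mult add one y *)
      ultimately show False
        using nz assms by (simp add: M_def)
    qed
  qed
  thus ?thesis
    using assms add by (simp add: M_def)
qed

lemma M_zero: "0 \<in> M"
  using zero by (simp add: M_def)

lemma M_sum: "(\<And>i. i \<in> J \<Longrightarrow> f i \<in> M) \<Longrightarrow> sum f J \<in> M"
  by (induction J rule: infinite_finite_induct) (auto intro: M_add M_zero)

lemma ex_dominant:
  assumes "finite J" "J \<noteq> {}" "\<And>j. j \<in> J \<Longrightarrow> t j \<noteq> 0"
  shows "\<exists>i\<in>J. \<forall>j\<in>J. t j / t i \<in> A"
  using assms
proof (induction J rule: finite_ne_induct)
  case (singleton i)
  thus ?case
    using one by simp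
next
  case (insert k J)
  then obtain i where i: "i \<in> J" "\<forall>j\<in>J. t j / t i \<in> A"
    by blast
  have nz: "t i \<noteq> 0" "t k \<noteq> 0"
    using insert.prems i by auto
  show ?case
  proof (cases "t k / t i \<in> A")
    case True
    thus ?thesis
      using i by blast
  next
    case False
    hence ik: "t i / t k \<in> A"
      using valuation_ring[of "t k / t i"] by simp
    have "t j / t k \<in> A" if "j \<in> J" for j
    proof -
      have "t j / t k = (t j / t i) * (t i / t k)"
        using nz by simp
      thus ?thesis
        using i ik that mult by metis
    qed
    thus ?thesis
      using nz one by (intro bexI[of _ k]) auto
  qed
qed

text \<open>The value group is torsion over the one of the base field.\<close>

definition has_value :: "'a alg_closure \<Rightarrow> real \<Rightarrow> bool" where
  "has_value x r \<longleftrightarrow> r \<ge> 0 \<and> (\<exists>n>0. \<exists>c. c \<noteq> 0 \<and> r ^ n = vabs c \<and>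
     x ^ n / to_ac c \<in> A \<and> to_ac c / x ^ n \<in> A)"

lemma ex_has_value:
  assumes x: "x \<noteq> 0"
  shows "\<exists>r. has_value x r"
proof -
  obtain p :: "'a poly" where p: "p \<noteq> 0" "poly (map_poly to_ac p) x = 0"
    using alg_closure_algebraic by blast
  define t where "t = (\<lambda>i. to_ac (coeff p i) * x ^ i)"
  define J where "J = {i. i \<le> degree p \<and> coeff p i \<noteq> 0}"
  have fin: "finite J" and ne: "J \<noteq> {}"
    using p(1) by (auto simp: J_def)
  have tnz: "t j \<noteq> 0" if "j \<in> J" for j
    using that x by (auto simp: t_def J_def)
  obtain i where i: "i \<in> J" "\<forall>j\<in>J. t j / t i \<in> A"
    using ex_dominant[of J t, OF fin ne tnz] by blast
  have "degree (map_poly to_ac p) = degree p"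
    by (rule degree_map_poly) (use p in auto)
  hence "0 = (\<Sum>j\<le>degree p. t j)"
    using p(2) by (simp add: poly_altdef t_def coeff_map_poly)
  also have "\<dots> = (\<Sum>j\<in>J. t j)"
    by (rule sum.mono_neutral_right) (auto simp: J_def t_def)
  also have "\<dots> = t i + (\<Sum>j\<in>J - {i}. t j)"
    by (rule sum.remove[OF fin i(1)])
  finally have "- t i = (\<Sum>j\<in>J - {i}. t j)"
    by (metis minus_unique)
  hence "- t i / t i = (\<Sum>j\<in>J - {i}. t j / t i)"
    by (simp only: sum_divide_distrib)
  moreover have "- t i / t i = - 1"
    using tnz[OF i(1)] by simp
  ultimately have "- 1 = (\<Sum>j\<in>J - {i}. t j / t i)"
    by simp
  moreover have "- 1 \<notin> M"
    using m1 by (simp add: M_def)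
  ultimately have "\<not> (\<forall>j\<in>J - {i}. t j / t i \<in> M)"
    using M_sum[of "J - {i}" "\<lambda>j. t j / t i"] by auto
  then obtain j where j: "j \<in> J" "j \<noteq> i" "t i / t j \<in> A" "t j / t i \<in> A"
    using i(2) by (auto simp: M_def)
  have main: "\<exists>r. has_value x r"
    if kl: "k \<in> J" "l \<in> J" "l < k" "t k / t l \<in> A" "t l / t k \<in> A" for k l
  proof -
    define c where "c = coeff p l / coeff p k"
    define n where "n = k - l"
    have n: "n > 0" "k = l + n"
      using kl by (auto simp: n_def)
    have c: "c \<noteq> 0" "coeff p k \<noteq> 0" "coeff p l \<noteq> 0"
      using kl by (auto simp: J_def c_def)
    have "x ^ n / to_ac c = t k / t l" "to_ac c / x ^ n = t l / t k"
      using c x by (simp_all add: t_def n(2) power_add c_def)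
    moreover have "root n (vabs c) ^ n = vabs c"
      using n by simp
    ultimately have "has_value x (root n (vabs c))"
      using n c kl unfolding has_value_def by (auto intro!: exI[of _ n] exI[of _ c])
    thus ?thesis ..
  qed
  show ?thesis
    using main[of i j] main[of j i] i j by (cases i j rule: linorder_cases) auto
qed

lemma has_value_pow:
  assumes "x ^ n / to_ac c \<in> A" "to_ac c / x ^ n \<in> A"
  shows "x ^ (n * m) / to_ac (c ^ m) \<in> A" "to_ac (c ^ m) / x ^ (n * m) \<in> A"
  using pow[OF assms(1), of m] pow[OF assms(2), of m] by (simp_all add: power_divide power_mult)

lemma vabs_eq_1:
  assumes "x \<noteq> 0" "x / to_ac c \<in> A" "to_ac c / x \<in> A" "x / to_ac d \<in> A" "to_ac d / x \<in> A"
    "c \<noteq> 0" "d \<noteq> 0"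
  shows "vabs c = vabs d"
proof -
  have "to_ac (c / d) = (to_ac c / x) * (x / to_ac d)" "to_ac (d / c) = (to_ac d / x) * (x / to_ac c)"
    using assms by simp_all
  hence "to_ac (c / d) \<in> A" "to_ac (d / c) \<in> A"
    using assms mult by metis+
  hence "vabs (c / d) \<le> 1" "vabs (d / c) \<le> 1"
    by (simp_all only: base_iff)
  moreover have "vabs c > 0" "vabs d > 0"
    using assms vabs_pos by blast+
  ultimately show ?thesis
    by (simp add: vabs_divide)
qed

lemma has_value_unique:
  assumes "x \<noteq> 0" "has_value x r" "has_value x s"
  shows "r = s"
proof -
  obtain n c where 1: "r \<ge> 0" "n > 0" "c \<noteq> 0" "r ^ n = vabs c" "x ^ n / to_ac c \<in> A" "to_ac c / x ^ n \<in> A"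
    using assms(2) unfolding has_value_def by blast
  obtain m d where 2: "s \<ge> 0" "m > 0" "d \<noteq> 0" "s ^ m = vabs d" "x ^ m / to_ac d \<in> A" "to_ac d / x ^ m \<in> A"
    using assms(3) unfolding has_value_def by blast
  have "vabs (c ^ m) = vabs (d ^ n)"
    using has_value_pow[OF 1(5,6), of m] has_value_pow[OF 2(5,6), of n] assms(1) 1(3) 2(3)
    by (intro vabs_eq_1[of "x ^ (n * m)"]) (simp_all add: mult.commute)
  hence "r ^ (n * m) = s ^ (n * m)"
    using 1(4) 2(4) by (simp add: vabs_power power_mult mult.commute[of n m])
      (metis power_mult mult.commute)
  thus ?thesis
    using 1 2 by (simp add: power_eq_iff_eq_base)
qed

lemma has_value_mult:
  assumes "x \<noteq> 0" "y \<noteq> 0" "has_value x r" "has_value y s"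
  shows "has_value (x * y) (r * s)"
proof -
  obtain n c where 1: "r \<ge> 0" "n > 0" "c \<noteq> 0" "r ^ n = vabs c" "x ^ n / to_ac c \<in> A" "to_ac c / x ^ n \<in> A"
    using assms(3) unfolding has_value_def by blast
  obtain m d where 2: "s \<ge> 0" "m > 0" "d \<noteq> 0" "s ^ m = vabs d" "y ^ m / to_ac d \<in> A" "to_ac d / y ^ m \<in> A"
    using assms(4) unfolding has_value_def by blast
  have x: "x ^ (n * m) / to_ac (c ^ m) \<in> A" "to_ac (c ^ m) / x ^ (n * m) \<in> A"
    using has_value_pow[OF 1(5,6)] by blast+
  have y: "y ^ (n * m) / to_ac (d ^ n) \<in> A" "to_ac (d ^ n) / y ^ (n * m) \<in> A"
    using has_value_pow[OF 2(5,6), of n] by (simp_all add: mult.commute)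
  have "(x * y) ^ (n * m) / to_ac (c ^ m * d ^ n) \<in> A" "to_ac (c ^ m * d ^ n) / (x * y) ^ (n * m) \<in> A"
    using mult[OF x(1) y(1)] mult[OF x(2) y(2)] by (simp_all add: power_mult_distrib)
  moreover have "(r * s) ^ (n * m) = vabs (c ^ m * d ^ n)"
  proof -
    have "r ^ (n * m) = vabs c ^ m" "s ^ (n * m) = vabs d ^ n"
      using 1 2 by (simp_all add: power_mult mult.commute[of n m] flip: 1(4) 2(4))
        (simp_all flip: power_mult add: mult.commute)
    thus ?thesis
      by (simp add: power_mult_distrib vabs_mult vabs_power)
  qed
  ultimately show ?thesis
    using 1 2 unfolding has_value_def
    by (intro conjI exI[of _ "n * m"] exI[of _ "c ^ m * d ^ n"]) auto
qed

lemma has_value_base: "c \<noteq> 0 \<Longrightarrow> has_value (to_ac c) (vabs c)"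
  unfolding has_value_def using one by (intro conjI exI[of _ 1] exI[of _ c]) auto

lemma has_value_le_1_iff:
  assumes "x \<noteq> 0" "has_value x r"
  shows "r \<le> 1 \<longleftrightarrow> x \<in> A"
proof -
  obtain n c where 1: "r \<ge> 0" "n > 0" "c \<noteq> 0" "r ^ n = vabs c" "x ^ n / to_ac c \<in> A" "to_ac c / x ^ n \<in> A"
    using assms(2) unfolding has_value_def by blast
  have "r \<le> 1 \<longleftrightarrow> vabs c \<le> 1"
    using 1 by (simp flip: 1(4) add: power_le_one_iff)
  also have "\<dots> \<longleftrightarrow> to_ac c \<in> A"
    by (simp add: base_iff)
  also have "\<dots> \<longleftrightarrow> x ^ n \<in> A"
    using mult[OF 1(5), of "to_ac c"] mult[OF 1(6), of "x ^ n"] 1 assms(1) by auto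
  also have "\<dots> \<longleftrightarrow> x \<in> A"
  proof
    assume xn: "x ^ n \<in> A"
    show "x \<in> A"
    proof (cases "inverse x \<in> A")
      case True
      have "x ^ n * inverse x ^ (n - 1) \<in> A"
        by (intro mult xn pow True)
      also have "x ^ n * inverse x ^ (n - 1) = x"
        using 1(2) assms(1) by (cases n) (simp_all add: field_simps)
      finally show ?thesis .
    qed (use valuation_ring[of x] in auto)
  qed (rule pow)
  finally show ?thesis .
qed

lemma ex_extension:
  "\<exists>v :: 'a alg_closure \<Rightarrow> real. nonarch_abs v \<and> (\<forall>c. v (to_ac c) = vabs c)"
proof -
  define v where "v = (\<lambda>x. if x = 0 then 0 else THE r. has_value x r)"
  have v: "has_value x (v x)" if nz: "x \<noteq> 0" for x
  proof -
    obtain r where r: "has_value x r"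
      using ex_has_value[OF nz] by blast
    hence "(THE r. has_value x r) = r"
      using has_value_unique[OF nz] by blast
    thus ?thesis
      using r nz by (simp add: v_def)
  qed
  have v0: "v 0 = 0"
    by (simp add: v_def)
  have eqI: "v x = r" if "has_value x r" "x \<noteq> 0" for x r
    using has_value_unique[OF that(2) v[OF that(2)] that(1)] .
  have nonneg: "v x \<ge> 0" for x
    using v[of x] v0 by (cases "x = 0") (auto simp: has_value_def)
  have eq0: "v x = 0 \<longleftrightarrow> x = 0" for x
  proof (cases "x = 0")
    case False
    then obtain n and c :: 'a where "n > 0" "c \<noteq> 0" "v x ^ n = vabs c"
      using v[of x] unfolding has_value_def by blast
    thus ?thesis
      using False vabs_pos[of c] by (auto simp: zero_power)
  qed (simp add: v0)
  have mult: "v (x * y) = v x * v y" for x y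
    using v0 eqI[OF has_value_mult[OF _ _ v v, of x y]] by (cases "x = 0 \<or> y = 0") auto
  have le1: "v x \<le> 1 \<longleftrightarrow> x \<in> A" for x
    using v0 zero has_value_le_1_iff[OF _ v, of x] by (cases "x = 0") auto
  have ultra_aux: "v (x + y) \<le> v y" if "v x \<le> v y" for x y
  proof (cases "y = 0")
    case True
    thus ?thesis
      using that eq0[of x] nonneg[of x] v0 by simp
  next
    case False
    hence vy: "v y > 0"
      using nonneg[of y] eq0[of y] by linarith
    have "v x = v (x / y) * v y"
      using False by (simp flip: mult)
    hence "v (x / y) \<le> 1"
      using that vy by simp
    hence "1 + x / y \<in> A"
      using le1 add one by blast
    hence "v (1 + x / y) * v y \<le> v y"
      using le1[of "1 + x / y"] vy by simp
    also have "v (1 + x / y) * v y = v (x + y)"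
      using False by (simp flip: mult add: algebra_simps)
    finally show ?thesis .
  qed
  have "v (x + y) \<le> max (v x) (v y)" for x y
    using ultra_aux[of x y] ultra_aux[of y x] by (cases "v x \<le> v y") (auto simp: add.commute)
  hence "nonarch_abs v"
    unfolding nonarch_abs_def using nonneg eq0 mult by blast
  moreover have "v (to_ac c) = vabs c" for c
    using v0 eqI[OF has_value_base, of c] by (cases "c = 0") auto
  ultimately show ?thesis
    by blast
qed

end

lemma ex_abs_extension_alg_closure:
  "\<exists>v :: 'a::nonarch_field alg_closure \<Rightarrow> real. nonarch_abs v \<and> (\<forall>c. v (to_ac c) = vabs c)"
proof -
  obtain A :: "'a alg_closure set" where
    "extends_ball A" "\<And>B. extends_ball B \<Longrightarrow> A \<subseteq> B \<Longrightarrow> B = A"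
    using ex_maximal_extends_ball by blast
  then interpret maximal_extends_ball A
    by unfold_locales
  show ?thesis
    by (rule ex_extension)
qed

text \<open>
  An extension of the absolute value exists over every base field; it is unique if the base field
  is complete, as the p-adic numbers are.
\<close>

instantiation alg_closure :: (nonarch_field) nonarch_field
begin

definition vabs_alg_closure :: "'a alg_closure \<Rightarrow> real"
  where "vabs_alg_closure = (SOME v. nonarch_abs v \<and> (\<forall>c. v (to_ac c) = vabs c))"

definition dist_alg_closure :: "'a alg_closure \<Rightarrow> 'a alg_closure \<Rightarrow> real"
  where "dist_alg_closure x y = vabs (x - y)"

definition uniformity_alg_closure :: "('a alg_closure \<times> 'a alg_closure) filter"
  where "uniformity_alg_closure = (INF e\<in>{0 <..}. principal {(x, y). dist x y < e})"

definition open_alg_closure :: "'a alg_closure set \<Rightarrow> bool"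
  where "open_alg_closure U \<longleftrightarrow> (\<forall>x\<in>U. eventually (\<lambda>(x', y). x' = x \<longrightarrow> y \<in> U) uniformity)"

instance
proof
  fix x y z :: "'a alg_closure"
  have v: "nonarch_abs (vabs :: 'a alg_closure \<Rightarrow> real)"
    using someI_ex[OF ex_abs_extension_alg_closure] unfolding vabs_alg_closure_def by blast
  thus "vabs x = 0 \<longleftrightarrow> x = 0" "vabs (x * y) = vabs x * vabs y" "vabs (x + y) \<le> max (vabs x) (vabs y)"
    by (simp_all add: nonarch_abs_def)
  show "dist x y = 0 \<longleftrightarrow> x = y" "dist x y \<le> dist x z + dist y z"
    using v nonarch_abs_triangle[OF v] by (simp_all add: nonarch_abs_def dist_alg_closure_def)
qed (fact dist_alg_closure_def uniformity_alg_closure_def open_alg_closure_def)+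

end

lemma vabs_to_ac [simp]: "vabs (to_ac c) = vabs c"
  using someI_ex[OF ex_abs_extension_alg_closure] unfolding vabs_alg_closure_def by blast

section \<open>p-adic numbers\<close>

text \<open>
  A copy of the rational numbers carrying the p-adic absolute value, where p is the prime CARD('p).
  Every prime number is the cardinality of some type of class \<^class>\<open>prime_card\<close>.
\<close>

typedef 'p padic_rat = "UNIV :: rat set"
  morphisms rat_of_padic_rat padic_rat_of_rat by simp

setup_lifting type_definition_padic_rat

definition padic_abs :: "nat \<Rightarrow> rat \<Rightarrow> real" where
  "padic_abs p r = (if r = 0 then 0 else
     real p powi (int (multiplicity (int p) (snd (quotient_of r))) -
                  int (multiplicity (int p) (fst (quotient_of r)))))"

lemma padic_abs_of_int_div:
  assumes "prime p" "a \<noteq> 0" "b \<noteq> 0"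
  shows "padic_abs p (of_int a / of_int b) =
    real p powi (int (multiplicity (int p) b) - int (multiplicity (int p) a))"
proof -
  define r :: rat where "r = of_int a / of_int b"
  obtain c d where cd: "quotient_of r = (c, d)"
    by fastforce
  have d: "d > 0" and r: "r = of_int c / of_int d"
    using quotient_of_denom_pos[OF cd] quotient_of_div[OF cd] by auto
  have nz: "r \<noteq> 0"
    using assms by (simp add: r_def)
  hence c: "c \<noteq> 0"
    using r by auto
  have "(of_int a :: rat) * of_int d = of_int c * of_int b"
    using r assms d unfolding r_def by (simp add: field_simps)
  hence "a * d = c * b"
    by (simp flip: of_int_mult)
  moreover have pe: "prime_elem (int p)"
    using assms(1) by simp
  ultimately have "multiplicity (int p) a + multiplicity (int p) d = multiplicity (int p) c + multiplicity (int p) b"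
    using prime_elem_multiplicity_mult_distrib[OF pe] assms(2,3) c d
    by (metis less_irrefl)
  hence "int (multiplicity (int p) d) - int (multiplicity (int p) c) =
      int (multiplicity (int p) b) - int (multiplicity (int p) a)"
    by linarith
  thus ?thesis
    using nz cd unfolding padic_abs_def r_def[symmetric] by simp
qed

lemma padic_abs_eq_0_iff:
  assumes "prime p" shows "padic_abs p r = 0 \<longleftrightarrow> r = 0"
  using prime_gt_0_nat[OF assms] by (simp add: padic_abs_def)

lemma rat_cases_int:
  fixes r :: rat
  assumes "r \<noteq> 0"
  obtains a b where "r = of_int a / of_int b" "a \<noteq> 0" "b \<noteq> 0"
  using assms quotient_of_div[of r] quotient_of_denom_pos[of r]
  by (metis div_0 less_irrefl of_int_0 surj_pair)

lemma padic_abs_mult: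
  assumes "prime p" shows "padic_abs p (r * s) = padic_abs p r * padic_abs p s"
proof (cases "r = 0 \<or> s = 0")
  case True
  thus ?thesis by (auto simp: padic_abs_def)
next
  case False
  then obtain a b c d where ab: "r = of_int a / of_int b" "a \<noteq> 0" "b \<noteq> 0"
      and cd: "s = of_int c / of_int d" "c \<noteq> 0" "d \<noteq> 0"
    by (metis rat_cases_int)
  have pe: "prime_elem (int p)" and p: "real p \<noteq> 0"
    using assms prime_gt_0_nat[OF assms] by auto
  have "r * s = of_int (a * c) / of_int (b * d)"
    by (simp add: ab cd)
  moreover have "multiplicity (int p) (a * c) = multiplicity (int p) a + multiplicity (int p) c"
    "multiplicity (int p) (b * d) = multiplicity (int p) b + multiplicity (int p) d"
    using pe ab cd by (simp_all add: prime_elem_multiplicity_mult_distrib)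
  moreover have "padic_abs p (of_int (a * c) / of_int (b * d)) =
      real p powi (int (multiplicity (int p) (b * d)) - int (multiplicity (int p) (a * c)))"
    using ab cd by (intro padic_abs_of_int_div[OF assms]) auto
  moreover have "padic_abs p r * padic_abs p s =
      real p powi (int (multiplicity (int p) b) - int (multiplicity (int p) a) +
        (int (multiplicity (int p) d) - int (multiplicity (int p) c)))"
    using p by (simp add: ab cd padic_abs_of_int_div[OF assms] power_int_add)
  ultimately show ?thesis
    by (simp add: algebra_simps)
qed

lemma padic_abs_ultra:
  assumes "prime p" shows "padic_abs p (r + s) \<le> max (padic_abs p r) (padic_abs p s)"
proof (cases "r = 0 \<or> s = 0 \<or> r + s = 0")
  case True
  moreover have "padic_abs p x \<ge> 0" for x
    by (simp add: padic_abs_def)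
  moreover have "padic_abs p 0 = 0"
    by (simp add: padic_abs_def)
  ultimately show ?thesis
    by (auto simp: max.coboundedI1)
next
  case False
  then obtain a b c d where ab: "r = of_int a / of_int b" "a \<noteq> 0" "b \<noteq> 0"
      and cd: "s = of_int c / of_int d" "c \<noteq> 0" "d \<noteq> 0"
    by (metis rat_cases_int)
  let ?v = "\<lambda>x. multiplicity (int p) x"
  have pe: "prime_elem (int p)" and p: "real p \<noteq> 0" "real p \<ge> 1"
    using assms prime_ge_1_nat[OF assms] by auto
  have rs: "r = of_int (a * d) / of_int (b * d)" "s = of_int (c * b) / of_int (b * d)"
    "r + s = of_int (a * d + c * b) / of_int (b * d)"
    using ab cd by (simp_all add: field_simps)
  have "a * d + c * b \<noteq> 0"
  proof
    assume "a * d + c * b = 0"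
    with rs(3) have "r + s = 0"
      by (simp only: of_int_0 div_0)
    thus False
      using False by blast
  qed
  hence nz: "a * d \<noteq> 0" "c * b \<noteq> 0" "b * d \<noteq> 0" "a * d + c * b \<noteq> 0"
    using ab cd by auto
  have "int p ^ min (?v (a * d)) (?v (c * b)) dvd a * d + c * b"
    by (intro dvd_add multiplicity_dvd') auto
  hence "min (?v (a * d)) (?v (c * b)) \<le> ?v (a * d + c * b)"
    using nz pe by (intro multiplicity_geI) auto
  hence "?v (a * d) \<le> ?v (a * d + c * b) \<or> ?v (c * b) \<le> ?v (a * d + c * b)"
    by linarith
  moreover have eqs: "padic_abs p r = real p powi (int (?v (b * d)) - int (?v (a * d)))"
    "padic_abs p s = real p powi (int (?v (b * d)) - int (?v (c * b)))"
    "padic_abs p (r + s) = real p powi (int (?v (b * d)) - int (?v (a * d + c * b)))"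
    using padic_abs_of_int_div[OF assms nz(1,3)] padic_abs_of_int_div[OF assms nz(2,3)]
      padic_abs_of_int_div[OF assms nz(4,3)]
    unfolding rs(1)[symmetric] rs(2)[symmetric] rs(3)[symmetric] by blast+
  ultimately show ?thesis
    using p(2) unfolding le_max_iff_disj eqs by (auto intro!: power_int_increasing)
qed


instantiation padic_rat :: (prime_card) field
begin

lift_definition zero_padic_rat :: "'a padic_rat" is 0 .
lift_definition one_padic_rat :: "'a padic_rat" is 1 .
lift_definition plus_padic_rat :: "'a padic_rat \<Rightarrow> 'a padic_rat \<Rightarrow> 'a padic_rat" is "(+)" .
lift_definition minus_padic_rat :: "'a padic_rat \<Rightarrow> 'a padic_rat \<Rightarrow> 'a padic_rat" is "(-)" .
lift_definition uminus_padic_rat :: "'a padic_rat \<Rightarrow> 'a padic_rat" is uminus .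
lift_definition times_padic_rat :: "'a padic_rat \<Rightarrow> 'a padic_rat \<Rightarrow> 'a padic_rat" is "(*)" .
lift_definition inverse_padic_rat :: "'a padic_rat \<Rightarrow> 'a padic_rat" is inverse .
lift_definition divide_padic_rat :: "'a padic_rat \<Rightarrow> 'a padic_rat \<Rightarrow> 'a padic_rat" is "(/)" .

instance
  by standard (transfer; simp add: algebra_simps divide_inverse)+

end

lemma of_nat_padic_rat: "rat_of_padic_rat (of_nat n) = of_nat n"
  by (induction n) (simp_all add: zero_padic_rat.rep_eq one_padic_rat.rep_eq plus_padic_rat.rep_eq)

instance padic_rat :: (prime_card) field_char_0
proof
  show "inj (of_nat :: nat \<Rightarrow> 'a padic_rat)"
    by (rule injI) (metis of_nat_eq_iff of_nat_padic_rat)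
qed

instantiation padic_rat :: (prime_card) nonarch_field
begin

lift_definition vabs_padic_rat :: "'a padic_rat \<Rightarrow> real" is "padic_abs CARD('a)" .

definition dist_padic_rat :: "'a padic_rat \<Rightarrow> 'a padic_rat \<Rightarrow> real"
  where "dist_padic_rat x y = vabs (x - y)"

definition uniformity_padic_rat :: "('a padic_rat \<times> 'a padic_rat) filter"
  where "uniformity_padic_rat = (INF e\<in>{0 <..}. principal {(x, y). dist x y < e})"

definition open_padic_rat :: "'a padic_rat set \<Rightarrow> bool"
  where "open_padic_rat U \<longleftrightarrow> (\<forall>x\<in>U. eventually (\<lambda>(x', y). x' = x \<longrightarrow> y \<in> U) uniformity)"

instance
proof
  fix x y z :: "'a padic_rat"
  have v: "nonarch_abs (vabs :: 'a padic_rat \<Rightarrow> real)"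
    unfolding nonarch_abs_def
  proof (intro allI conjI)
    fix x y :: "'a padic_rat"
    show "vabs x \<ge> 0"
      by transfer (simp add: padic_abs_def)
    show "vabs x = 0 \<longleftrightarrow> x = 0"
      by transfer (rule padic_abs_eq_0_iff[OF prime_card])
    show "vabs (x * y) = vabs x * vabs y"
      by transfer (rule padic_abs_mult[OF prime_card])
    show "vabs (x + y) \<le> max (vabs x) (vabs y)"
      by transfer (rule padic_abs_ultra[OF prime_card])
  qed
  thus "vabs x = 0 \<longleftrightarrow> x = 0" "vabs (x * y) = vabs x * vabs y" "vabs (x + y) \<le> max (vabs x) (vabs y)"
    by (simp_all add: nonarch_abs_def)
  show "dist x y = 0 \<longleftrightarrow> x = y" "dist x y \<le> dist x z + dist y z"
    using v nonarch_abs_triangle[OF v] by (simp_all add: nonarch_abs_def dist_padic_rat_def)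
qed (fact dist_padic_rat_def uniformity_padic_rat_def open_padic_rat_def)+

end

text \<open>
  Completing the rational numbers gives the field of p-adic numbers;
  completing its algebraic closure gives the field \<open>\<complex>\<^sub>p\<close> of p-adic complex numbers.
  The absolute value is normalised by |p| = 1/p.
\<close>

type_synonym 'p padic = "'p padic_rat completion"

type_synonym 'p padic_complex = "'p padic alg_closure completion"

definition padic_int :: "'p::prime_card padic set"
  where "padic_int = {x. vabs x \<le> 1}"

definition padic_to_complex :: "'p::prime_card padic \<Rightarrow> 'p padic_complex"
  where "padic_to_complex x = to_completion (to_ac x)"

section \<open>The Volkenborn integral\<close>

text \<open>
  Functions on the p-adic integers are represented by functions on all p-adic numbers,
  of which only the values on \<^const>\<open>padic_int\<close> are used.

  Uniform differentiability: at every point a the difference quotient in two variables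
  has a limit for (u, v) tending to (a, a) off the diagonal.
\<close>

definition uniformly_differentiable :: "('p::prime_card padic \<Rightarrow> 'p padic_complex) \<Rightarrow> bool"
  where "uniformly_differentiable f \<longleftrightarrow> (\<forall>a\<in>padic_int. \<exists>l.
    ((\<lambda>(u, v). (f u - f v) / padic_to_complex (u - v)) \<longlongrightarrow> l)
      (at (a, a) within {(u, v). u \<in> padic_int \<and> v \<in> padic_int \<and> u \<noteq> v}))"

definition volkenborn_sum :: "('p::prime_card padic \<Rightarrow> 'p padic_complex) \<Rightarrow> nat \<Rightarrow> 'p padic_complex"
  where "volkenborn_sum f N = 1 / of_nat (CARD('p) ^ N) * (\<Sum>y<CARD('p) ^ N. f (of_nat y))"

definition volkenborn_integrable :: "('p::prime_card padic \<Rightarrow> 'p padic_complex) \<Rightarrow> bool"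
  where "volkenborn_integrable f \<longleftrightarrow> uniformly_differentiable f \<and> convergent (volkenborn_sum f)"

definition volkenborn_integral :: "('p::prime_card padic \<Rightarrow> 'p padic_complex) \<Rightarrow> 'p padic_complex"
  where "volkenborn_integral f = lim (volkenborn_sum f)"

section \<open>Bernoulli and Daehee polynomials, Stirling numbers\<close>

text \<open>
  The polynomials are given by their values in a field of characteristic 0. In the definition of the
  Daehee polynomials, \<^term>\<open>fps_ln 1\<close> is the series of log(1 + t) and
  \<^term>\<open>fps_binomial x\<close> the one of (1 + t) to the power x; both quotients of power series
  are exact.
\<close>

definition bernoulli_poly :: "nat \<Rightarrow> 'a::field_char_0 \<Rightarrow> 'a"
  where "bernoulli_poly n x = fact n * fps_nth (fps_X / (fps_exp 1 - 1) * fps_exp x) n"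

definition daehee2_poly :: "nat \<Rightarrow> 'a::field_char_0 \<Rightarrow> 'a"
  where "daehee2_poly n x =
    fact n * fps_nth ((1 + fps_X) * fps_ln 1 / fps_X * (1 / fps_binomial x)) n"

lemma Stirling_generating_function:
  "(fps_exp 1 - 1) ^ m = fps_const (fact m) * Abs_fps (\<lambda>l. of_nat (Stirling l m) / fact l :: 'a::field_char_0)"
proof (induction m)
  case 0
  have "Stirling l 0 = (if l = 0 then 1 else 0)" for l
    by (cases l) simp_all
  thus ?case
    by (intro fps_ext) simp
next
  case (Suc m)
  define G :: "nat \<Rightarrow> 'a fps" where "G = (\<lambda>m. Abs_fps (\<lambda>l. of_nat (Stirling l m) / fact l))"
  define D where "D = (fps_exp 1 - 1) ^ Suc m - fps_const (fact (Suc m)) * G (Suc m)"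
  have G': "fps_deriv (G (Suc m)) = G m + of_nat (Suc m) * G (Suc m)"
  proof (rule fps_ext)
    fix l
    have "fps_nth (fps_deriv (G (Suc m))) l = of_nat (Stirling (Suc l) (Suc m)) / fact l"
      by (simp add: G_def field_simps del: Stirling.simps of_nat_Suc)
    also have "\<dots> = fps_nth (G m + of_nat (Suc m) * G (Suc m)) l"
      by (simp add: G_def add_divide_distrib fps_mult_of_nat_nth distrib_right)
    finally show "fps_nth (fps_deriv (G (Suc m))) l = fps_nth (G m + of_nat (Suc m) * G (Suc m)) l" .
  qed
  have "fps_deriv ((fps_exp 1 - 1 :: 'a fps) ^ Suc m) = of_nat (Suc m) * (fps_exp 1 - 1) ^ m * fps_exp 1"
    by (simp add: fps_deriv_power mult_ac fps_of_nat del: of_nat_Suc power_Suc)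
  also have "\<dots> = of_nat (Suc m) * (fps_exp 1 - 1) ^ m + of_nat (Suc m) * (fps_exp 1 - 1) ^ Suc m"
    by (simp add: algebra_simps del: of_nat_Suc)
  also have "(fps_exp 1 - 1) ^ m = fps_const (fact m) * G m"
    using Suc.IH by (simp add: G_def)
  finally have E': "fps_deriv ((fps_exp 1 - 1 :: 'a fps) ^ Suc m) =
      of_nat (Suc m) * (fps_const (fact m) * G m) + of_nat (Suc m) * (fps_exp 1 - 1) ^ Suc m" .
  have c: "fps_const (fact (Suc m)) = of_nat (Suc m) * fps_const (fact m :: 'a)"
    by (simp only: fact_Suc fps_const_mult[symmetric] fps_of_nat)
  have "fps_deriv D = of_nat (Suc m) * (fps_const (fact m) * G m) + of_nat (Suc m) * (fps_exp 1 - 1) ^ Suc m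
      - fps_const (fact (Suc m)) * (G m + of_nat (Suc m) * G (Suc m))"
    by (simp only: D_def fps_deriv_sub E' fps_deriv_mult_const_left G')
  also have "\<dots> = of_nat (Suc m) * D"
    unfolding D_def c by (simp add: algebra_simps del: of_nat_Suc power_Suc)
  finally have "fps_deriv D = of_nat (Suc m) * D" .
  hence "fps_deriv D = fps_const (of_nat (Suc m)) * D"
    by (simp only: fps_of_nat)
  hence "D = fps_const (fps_nth D 0) * fps_exp (of_nat (Suc m))"
    using fps_exp_unique_ODE by blast
  moreover have "fps_nth D 0 = 0"
    by (simp add: D_def G_def)
  ultimately have "D = 0"
    by simp
  thus ?case
    by (simp add: D_def G_def)
qed

end

theory Submission
  imports Defs
begin

text \<open>
  With \<open>F\<^sub>a = t e\<^sup>a\<^sup>t / (e\<^sup>t - 1)\<close>, the sum \<open>t \<Sum>y<M. e\<^bsup>(a+y)t\<^esup>\<close> telescopes to \<open>F\<^sub>a (e\<^sup>M\<^sup>t - 1)\<close>.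
  Comparing coefficients and dividing by M expresses the mean of \<open>(a + y)\<^sup>m\<close> over \<open>y < M\<close> as a
  polynomial in M with constant term \<open>B\<^sub>m(a)\<close>, and \<open>M = p\<^sup>N\<close> tends to 0 p-adically. The reflection
  formula is the substitution of \<open>- t\<close> for t in \<open>F\<^sub>a\<close>, and the Daehee formula is the substitution of
  \<open>e\<^sup>t - 1\<close> for t in the generating function of the Daehee polynomials, which yields \<open>F\<^bsub>1-x\<^esub>\<close>.
\<close>

section \<open>Topology of non-archimedean fields\<close>

lemma tendsto_vabs_iff:
  fixes f :: "'b \<Rightarrow> 'a::nonarch_field"
  shows "(f \<longlongrightarrow> l) F \<longleftrightarrow> ((\<lambda>x. vabs (f x - l)) \<longlongrightarrow> 0) F"
  by (subst tendsto_dist_iff) (simp add: dist_vabs)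

lemma tendsto_vabs_le:
  fixes f :: "'b \<Rightarrow> 'a::nonarch_field"
  assumes "(g \<longlongrightarrow> 0) F" "\<And>x. vabs (f x - l) \<le> g x"
  shows "(f \<longlongrightarrow> l) F"
  unfolding tendsto_vabs_iff
  by (rule tendsto_sandwich[OF _ _ tendsto_const assms(1)]) (simp_all add: assms(2))

lemma tendsto_fst_prod_nhds: "(fst \<longlongrightarrow> a) (nhds a \<times>\<^sub>F nhds b)"
  and tendsto_snd_prod_nhds: "(snd \<longlongrightarrow> b) (nhds a \<times>\<^sub>F nhds b)"
  by (simp_all add: filterlim_def filtermap_fst_prod_filter filtermap_snd_prod_filter)

text \<open>The absolute value is no norm over the reals, since \<open>vabs 2\<close> is at most 1.
  This instance and the next therefore supply the limit rules for sums and products.\<close>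

instance nonarch_field \<subseteq> topological_ab_group_add
proof
  fix a b :: 'a
  let ?F = "nhds a \<times>\<^sub>F nhds b"
  have "((\<lambda>z. vabs (fst z - a)) \<longlongrightarrow> 0) ?F" "((\<lambda>z. vabs (snd z - b)) \<longlongrightarrow> 0) ?F"
    by (simp_all flip: tendsto_vabs_iff add: tendsto_fst_prod_nhds tendsto_snd_prod_nhds)
  from tendsto_add_zero[OF this]
  show "((\<lambda>z. fst z + snd z) \<longlongrightarrow> a + b) ?F"
    by (rule tendsto_vabs_le) (simp only: add_diff_add vabs_add_le)
  have "((\<lambda>z. vabs (z - a)) \<longlongrightarrow> 0) (nhds a)"
    by (simp flip: tendsto_vabs_iff add: filterlim_ident)
  then show "(uminus \<longlongrightarrow> - a) (nhds a)"
    by (simp add: tendsto_vabs_iff[of _ "- a"] vabs_minus_commute)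
qed

instance nonarch_field \<subseteq> topological_comm_monoid_mult
proof
  fix a b :: 'a
  let ?F = "nhds a \<times>\<^sub>F nhds b"
  have *: "((\<lambda>z. vabs (fst z - a)) \<longlongrightarrow> 0) ?F" "((\<lambda>z. vabs (snd z - b)) \<longlongrightarrow> 0) ?F"
    by (simp_all flip: tendsto_vabs_iff add: tendsto_fst_prod_nhds tendsto_snd_prod_nhds)
  have "vabs (fst z * snd z - a * b) \<le> vabs (fst z - a) * vabs (snd z - b)
      + (vabs (fst z - a) * vabs b + vabs a * vabs (snd z - b))" for z
  proof -
    have "fst z * snd z - a * b =
        (fst z - a) * (snd z - b) + ((fst z - a) * b + a * (snd z - b))"
      by (simp add: algebra_simps)
    then show ?thesis
      using vabs_add_le[of "(fst z - a) * (snd z - b)" "(fst z - a) * b + a * (snd z - b)"]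
        vabs_add_le[of "(fst z - a) * b" "a * (snd z - b)"]
      by (simp add: vabs_mult)
  qed
  note le = this
  have "((\<lambda>z. vabs (fst z - a) * vabs (snd z - b)
      + (vabs (fst z - a) * vabs b + vabs a * vabs (snd z - b))) \<longlongrightarrow> 0) ?F"
    using * by (auto intro!: tendsto_eq_intros)
  then show "((\<lambda>z. fst z * snd z) \<longlongrightarrow> a * b) ?F"
    by (rule tendsto_vabs_le) (rule le)
qed

section \<open>Embedding the p-adic numbers\<close>

lemma padic_to_complex_of_nat [simp]: "padic_to_complex (of_nat n) = of_nat n"
  by (simp add: padic_to_complex_def)

lemma padic_to_complex_diff: "padic_to_complex (x - y) = padic_to_complex x - padic_to_complex y"
  by (simp add: padic_to_complex_def)

lemma padic_to_complex_eq_iff [simp]: "padic_to_complex x = padic_to_complex y \<longleftrightarrow> x = y"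
  by (simp add: padic_to_complex_def)

lemma vabs_padic_to_complex [simp]: "vabs (padic_to_complex x) = vabs x"
  by (simp add: padic_to_complex_def)

lemma tendsto_padic_to_complex [tendsto_intros]:
  "(f \<longlongrightarrow> l) F \<Longrightarrow> ((\<lambda>x. padic_to_complex (f x)) \<longlongrightarrow> padic_to_complex l) F"
  unfolding tendsto_vabs_iff by (simp flip: padic_to_complex_diff)

text \<open>The embeddings of the rationals into the p-adic numbers and of these into their complex
  counterpart are isometric and fix natural numbers, so the value is computed on the
  rationals.\<close>

lemma vabs_of_nat_CARD: "vabs (of_nat CARD('p) :: 'p::prime_card padic_complex) = 1 / CARD('p)"
proof -
  have p: "prime CARD('p)"
    by (rule prime_card)
  have "(of_nat CARD('p) :: 'p padic_complex) =
      padic_to_complex (to_completion (of_nat CARD('p)))"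
    by simp
  then have "vabs (of_nat CARD('p) :: 'p padic_complex) =
      vabs (of_nat CARD('p) :: 'p padic_rat)"
    by (simp only: vabs_padic_to_complex vabs_to_completion)
  also have "\<dots> = padic_abs CARD('p) (of_int (int CARD('p)) / of_int 1)"
    by (simp add: vabs_padic_rat.rep_eq of_nat_padic_rat)
  also have "\<dots> = 1 / CARD('p)"
    using p prime_gt_0_nat[OF p]
    by (subst padic_abs_of_int_div) (auto simp: power_int_minus field_simps)
  finally show ?thesis .
qed

lemma prime_power_tendsto_0:
  "(\<lambda>N. of_nat (CARD('p) ^ N) :: 'p::prime_card padic_complex) \<longlonglongrightarrow> 0"
proof -
  have "(\<lambda>N. (1 / real CARD('p)) ^ N) \<longlonglongrightarrow> 0"
    using prime_gt_1_nat[OF prime_card[where 'a='p]] by (intro LIMSEQ_power_zero) simp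
  then show ?thesis
    by (simp add: tendsto_vabs_iff vabs_power vabs_of_nat_CARD)
qed

text \<open>Off the diagonal the difference quotient equals the polynomial \<open>?g\<close> in both
  variables, which is continuous, so the limit is its value at \<open>(a, a)\<close>.\<close>

lemma uniformly_differentiable_power:
  "uniformly_differentiable (\<lambda>y::'p::prime_card padic. (c + padic_to_complex y) ^ m)"
  unfolding uniformly_differentiable_def
proof (intro ballI exI)
  fix a :: "'p padic"
  let ?S = "{(u, v). u \<in> padic_int \<and> v \<in> padic_int \<and> u \<noteq> v} :: ('p padic \<times> 'p padic) set"
  \<comment> \<open>This is m (c + a)^(m-1), left in the shape of \<open>?g\<close> evaluated on the
    diagonal.\<close>
  let ?l = "\<Sum>i<m. (c + padic_to_complex a) ^ (m - Suc i) * (c + padic_to_complex a) ^ i"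
  let ?g = "\<lambda>(u, v). \<Sum>i<m. (c + padic_to_complex v) ^ (m - Suc i) * (c + padic_to_complex u) ^ i"
  let ?q = "\<lambda>(u, v). ((c + padic_to_complex u) ^ m - (c + padic_to_complex v) ^ m)
    / padic_to_complex (u - v)"
  have "(?g \<longlongrightarrow> ?l) (at (a, a) within ?S)"
    unfolding case_prod_unfold by (auto intro!: tendsto_eq_intros tendsto_sum)
  moreover have "?q z = ?g z" if "z \<in> ?S" for z
    using that
    by (auto simp: power_diff_sumr2 padic_to_complex_diff)
  then have "\<forall>\<^sub>F z in at (a, a) within ?S. ?q z = ?g z"
    by (simp add: eventually_at_filter)
  ultimately show "(?q \<longlongrightarrow> ?l) (at (a, a) within ?S)"
    by (simp only: filterlim_cong[OF refl refl])
qed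

section \<open>Generating functions\<close>

definition bernoulli_gf :: "'a::field_char_0 \<Rightarrow> 'a fps"
  where "bernoulli_gf x = fps_X / (fps_exp 1 - 1) * fps_exp x"

lemma bernoulli_poly_gf: "bernoulli_poly n x = fact n * bernoulli_gf x $ n"
  by (simp add: bernoulli_poly_def bernoulli_gf_def)

lemma fps_exp_1_minus_1_nonzero: "fps_exp 1 - 1 \<noteq> (0 :: 'a::field_char_0 fps)"
proof
  assume "fps_exp 1 - 1 = (0 :: 'a fps)"
  then have "(fps_exp 1 - 1) $ 1 = (0 :: 'a fps) $ 1"
    by simp
  then show False
    by simp
qed

lemma bernoulli_gf_mult: "bernoulli_gf x * (fps_exp 1 - 1) = fps_X * fps_exp x"
proof -
  \<comment> \<open>e^t - 1 is not a unit, but its order of vanishing equals that of t, so the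
    quotient in \<open>bernoulli_gf\<close> is exact.\<close>
  have "subdegree (fps_exp 1 - 1 :: 'a fps) = 1"
    by (intro subdegreeI) auto
  then have "fps_exp 1 - 1 dvd (fps_X :: 'a fps)"
    by (simp add: fps_dvd_iff fps_exp_1_minus_1_nonzero)
  then show ?thesis
    by (simp add: bernoulli_gf_def mult.commute mult.left_commute)
qed

text \<open>Power series over a field form an integral domain, so e^t - 1 cancels. Series obtained
  by substitution are identified through this equation without handling quotients.\<close>

lemma bernoulli_gf_unique:
  assumes "G * (fps_exp 1 - 1) = fps_X * fps_exp x"
  shows "G = bernoulli_gf x"
proof -
  have "G * (fps_exp 1 - 1) = bernoulli_gf x * (fps_exp 1 - 1)"
    by (simp only: assms bernoulli_gf_mult)
  then show ?thesis
    by (simp only: mult_right_cancel[OF fps_exp_1_minus_1_nonzero])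
qed

lemma bernoulli_gf_add: "bernoulli_gf (x + y) = bernoulli_gf x * fps_exp y"
  by (simp add: bernoulli_gf_def fps_exp_add_mult mult.assoc)

lemma bernoulli_gf_reflect: "bernoulli_gf x oo - fps_X = bernoulli_gf (1 - x)"
proof (rule bernoulli_gf_unique)
  let ?G = "bernoulli_gf x oo - fps_X"
  have E: "fps_exp c oo - fps_X = fps_exp (- c)" for c :: 'a
    using fps_exp_compose_linear[of c "- 1"] by (simp add: fps_const_neg[symmetric] del: fps_const_neg)
  have "(bernoulli_gf x * (fps_exp 1 - 1)) oo - fps_X = (fps_X * fps_exp x) oo - fps_X"
    by (simp only: bernoulli_gf_mult)
  then have "?G * (fps_exp (- 1) - 1) = - fps_X * fps_exp (- x)"
    by (simp add: fps_compose_mult_distrib fps_compose_sub_distrib E)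
  \<comment> \<open>The factor -e^t turns e^(-t) - 1 back into e^t - 1.\<close>
  then have "?G * (fps_exp (- 1) - 1) * - fps_exp 1 = - fps_X * fps_exp (- x) * - fps_exp 1"
    by simp
  moreover have "fps_exp (- 1) * fps_exp 1 = (1 :: 'a fps)" "fps_exp (- x) * fps_exp 1 = fps_exp (1 - x)"
    by (simp_all flip: fps_exp_add_mult)
  ultimately show "?G * (fps_exp 1 - 1) = fps_X * fps_exp (1 - x)"
    by (simp add: algebra_simps)
qed

lemma bernoulli_poly_reflect: "bernoulli_poly n (1 - x) = (-1) ^ n * bernoulli_poly n x"
  by (simp add: bernoulli_poly_gf fps_compose_uminus' flip: bernoulli_gf_reflect)

section \<open>Substitution of e^t - 1 in the Daehee generating function\<close>

lemma fps_ln_compose_exp: "fps_ln 1 oo (fps_exp 1 - 1) = (fps_X :: 'a::field_char_0 fps)"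
  by (simp add: fps_ln_fps_exp_inv fps_inv)

text \<open>The series B of (1+t)^x satisfies (1+t) B' = x B; after the substitution this becomes
  the equation C' = x C of the exponential, with C(0) = 1.\<close>

lemma fps_binomial_compose_exp: "fps_binomial x oo (fps_exp 1 - 1) = fps_exp x"
proof -
  let ?B = "fps_binomial x oo (fps_exp 1 - 1)"
  have "fps_deriv (fps_binomial x) * (1 + fps_X) = fps_const x * fps_binomial x"
    by (simp add: fps_binomial_deriv fps_divide_unit mult.assoc inverse_mult_eq_1)
  then have "(fps_deriv (fps_binomial x) * (1 + fps_X)) oo (fps_exp 1 - 1) =
      (fps_const x * fps_binomial x) oo (fps_exp 1 - 1)"
    by simp
  \<comment> \<open>The image e^t of 1 + t is exactly the inner derivative in the chain
    rule.\<close>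
  then have "fps_deriv ?B = fps_const x * ?B"
    by (simp add: fps_compose_mult_distrib fps_compose_add_distrib fps_compose_deriv)
  then have "?B = fps_const (?B $ 0) * fps_exp x"
    by (simp only: fps_exp_unique_ODE)
  then show ?thesis
    by simp
qed

definition daehee2_gf :: "'a::field_char_0 \<Rightarrow> 'a fps"
  where "daehee2_gf x = (1 + fps_X) * fps_ln 1 / fps_X * (1 / fps_binomial x)"

text \<open>Both quotients are exact: t divides log(1+t), and (1+t)^x has constant term 1. Without
  denominators, substitution can act factor by factor.\<close>

lemma daehee2_gf_mult: "daehee2_gf x * (fps_X * fps_binomial x) = (1 + fps_X) * fps_ln 1"
proof -
  have "(1 + fps_X) * fps_ln 1 / fps_X * fps_X = (1 + fps_X) * fps_ln (1::'a)"
    by (intro dvd_div_mult_self dvd_mult) simp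
  moreover have "1 / fps_binomial x * fps_binomial x = 1"
    by (simp add: fps_divide_unit inverse_mult_eq_1)
  moreover have "daehee2_gf x * (fps_X * fps_binomial x) =
      ((1 + fps_X) * fps_ln 1 / fps_X * fps_X) * (1 / fps_binomial x * fps_binomial x)"
    unfolding daehee2_gf_def by (simp only: ac_simps)
  ultimately show ?thesis
    by simp
qed

lemma daehee2_gf_compose_exp: "daehee2_gf x oo (fps_exp 1 - 1) = bernoulli_gf (1 - x)"
proof (rule bernoulli_gf_unique)
  let ?G = "daehee2_gf x oo (fps_exp 1 - 1)"
  have "(daehee2_gf x * (fps_X * fps_binomial x)) oo (fps_exp 1 - 1) =
      ((1 + fps_X) * fps_ln 1) oo (fps_exp 1 - 1)"
    by (simp only: daehee2_gf_mult)
  then have "?G * ((fps_exp 1 - 1) * fps_exp x) = fps_exp 1 * fps_X"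
    by (simp add: fps_compose_mult_distrib fps_compose_add_distrib
        fps_ln_compose_exp fps_binomial_compose_exp)
  from arg_cong[OF this, of "\<lambda>f. f * fps_exp (- x)"]
  have "?G * (fps_exp 1 - 1) * (fps_exp x * fps_exp (- x)) = fps_X * (fps_exp 1 * fps_exp (- x))"
    by (simp only: ac_simps)
  then show "?G * (fps_exp 1 - 1) = fps_X * fps_exp (1 - x)"
    by (simp flip: fps_exp_add_mult)
qed

lemma bernoulli_poly_daehee2_Stirling:
  "bernoulli_poly m (1 - x) = (\<Sum>n=0..m. daehee2_poly n x * of_nat (Stirling m n))"
proof -
  have "bernoulli_poly m (1 - x) = fact m * (daehee2_gf x oo (fps_exp 1 - 1)) $ m"
    by (simp add: bernoulli_poly_gf daehee2_gf_compose_exp)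
  \<comment> \<open>The n-th power of e^t - 1 has m-th coefficient n! S(m,n) / m!; the factor n!
    turns the coefficient of \<open>daehee2_gf\<close> into \<open>daehee2_poly\<close>.\<close>
  also have "\<dots> = (\<Sum>n=0..m. fact m * (daehee2_gf x $ n * (fact n * (of_nat (Stirling m n) / fact m))))"
    by (simp add: fps_compose_nth Stirling_generating_function sum_distrib_left)
  also have "\<dots> = (\<Sum>n=0..m. daehee2_poly n x * of_nat (Stirling m n))"
    by (intro sum.cong) (simp_all add: daehee2_poly_def daehee2_gf_def)
  finally show ?thesis .
qed

section \<open>Power sums\<close>

lemma sum_power_bernoulli_gf:
  "(\<Sum>y<M. (a + of_nat y) ^ m) =
    fact m * (\<Sum>i\<le>m. bernoulli_gf a $ i * (of_nat M ^ (Suc m - i) / fact (Suc m - i)))"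
proof -
  have "bernoulli_gf (a + of_nat (Suc y)) - bernoulli_gf (a + of_nat y) = fps_X * fps_exp (a + of_nat y)" for y
  proof -
    have "bernoulli_gf (a + of_nat (Suc y)) = bernoulli_gf (a + of_nat y) * fps_exp 1"
      by (simp only: of_nat_Suc flip: bernoulli_gf_add) (simp add: ac_simps)
    then show ?thesis
      using bernoulli_gf_mult[of "a + of_nat y"] by (simp add: algebra_simps)
  qed
  then have "(\<Sum>y<M. fps_X * fps_exp (a + of_nat y)) = bernoulli_gf (a + of_nat M) - bernoulli_gf a"
    using sum_lessThan_telescope[of "\<lambda>y. bernoulli_gf (a + of_nat y)" M] by simp
  \<comment> \<open>The index is \<open>Suc m\<close> because of the factor t in each
    summand.\<close>
  then have "(\<Sum>y<M. fps_X * fps_exp (a + of_nat y)) $ Suc m =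
      (bernoulli_gf a * fps_exp (of_nat M) - bernoulli_gf a) $ Suc m"
    by (simp add: bernoulli_gf_add)
  moreover have "(fps_X * fps_exp (a + of_nat y)) $ Suc m = (a + of_nat y) ^ m / fact m" for y
    by simp
  \<comment> \<open>The product's term for i = m + 1 cancels against the subtracted series, so every
    remaining power of M is at least the first and division by M leaves a polynomial.\<close>
  moreover have "(bernoulli_gf a * fps_exp (of_nat M) - bernoulli_gf a) $ Suc m =
      (\<Sum>i\<le>m. bernoulli_gf a $ i * (of_nat M ^ (Suc m - i) / fact (Suc m - i)))"
    by (simp add: fps_mult_nth atMost_atLeast0)
  ultimately have "(\<Sum>y<M. (a + of_nat y) ^ m / fact m) =
      (\<Sum>i\<le>m. bernoulli_gf a $ i * (of_nat M ^ (Suc m - i) / fact (Suc m - i)))"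
    by (simp only: fps_sum_nth)
  then show ?thesis
    by (simp flip: sum_divide_distrib add: field_simps)
qed

lemma mean_power_bernoulli_gf:
  assumes "M > 0"
  shows "1 / of_nat M * (\<Sum>y<M. (a + of_nat y) ^ m) =
    fact m * (\<Sum>i\<le>m. bernoulli_gf a $ i * (of_nat M ^ (m - i) / fact (Suc m - i)))"
proof -
  have "1 / of_nat M * (\<Sum>y<M. (a + of_nat y) ^ m) = fact m *
      (\<Sum>i\<le>m. 1 / of_nat M * (bernoulli_gf a $ i * (of_nat M ^ (Suc m - i) / fact (Suc m - i))))"
    by (simp only: sum_power_bernoulli_gf sum_distrib_left mult.left_commute)
  also have "(\<Sum>i\<le>m. 1 / of_nat M * (bernoulli_gf a $ i * (of_nat M ^ (Suc m - i) / fact (Suc m - i)))) =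
      (\<Sum>i\<le>m. bernoulli_gf a $ i * (of_nat M ^ (m - i) / fact (Suc m - i)))"
    using assms by (intro sum.cong) (simp_all add: Suc_diff_le del: fact_Suc)
  finally show ?thesis .
qed

lemma volkenborn_sum_power_tendsto:
  "volkenborn_sum (\<lambda>y::'p::prime_card padic. (a + padic_to_complex y) ^ m) \<longlonglongrightarrow> bernoulli_poly m a"
proof -
  have "volkenborn_sum (\<lambda>y::'p padic. (a + padic_to_complex y) ^ m) =
      (\<lambda>N. fact m * (\<Sum>i\<le>m. bernoulli_gf a $ i * (of_nat (CARD('p) ^ N) ^ (m - i) * inverse (fact (Suc m - i)))))"
    using prime_gt_0_nat[OF prime_card[where 'a='p]]
    unfolding volkenborn_sum_def padic_to_complex_of_nat divide_inverse[symmetric]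
    by (intro ext mean_power_bernoulli_gf) simp
  also have "\<dots> \<longlonglongrightarrow> fact m * (\<Sum>i\<le>m. bernoulli_gf a $ i * (0 ^ (m - i) * inverse (fact (Suc m - i))))"
    by (intro tendsto_intros prime_power_tendsto_0)
  \<comment> \<open>As 0^0 = 1, only i = m survives, with factor 1/1!.\<close>
  also have "(\<Sum>i\<le>m. bernoulli_gf a $ i * (0 ^ (m - i) * inverse (fact (Suc m - i)))) = bernoulli_gf a $ m"
    by (subst sum.remove[of _ m]) (auto intro!: sum.neutral)
  finally show ?thesis
    by (simp add: bernoulli_poly_gf)
qed

theorem theorem7:
  fixes x :: "'p::prime_card padic" and m :: nat
  assumes "x \<in> padic_int"
  shows "volkenborn_integrable (\<lambda>y. (padic_to_complex x + padic_to_complex y) ^ m)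
    \<and> bernoulli_poly m (1 - padic_to_complex x)
        = (-1) ^ m * volkenborn_integral (\<lambda>y. (padic_to_complex x + padic_to_complex y) ^ m)
    \<and> (-1) ^ m * volkenborn_integral (\<lambda>y. (padic_to_complex x + padic_to_complex y) ^ m)
        = (\<Sum>n=0..m. daehee2_poly n (padic_to_complex x) * of_nat (Stirling m n))
    \<and> bernoulli_poly m (1 - padic_to_complex x) = (-1) ^ m * bernoulli_poly m (padic_to_complex x)
    \<and> (-1) ^ m * bernoulli_poly m (padic_to_complex x)
        = (\<Sum>n=0..m. daehee2_poly n (padic_to_complex x) * of_nat (Stirling m n))"
proof -
  let ?f = "\<lambda>y::'p padic. (padic_to_complex x + padic_to_complex y) ^ m"
  note L = volkenborn_sum_power_tendsto[of "padic_to_complex x" m]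
  have "volkenborn_integrable ?f"
    unfolding volkenborn_integrable_def
    using uniformly_differentiable_power L by (blast intro: convergentI)
  moreover have "volkenborn_integral ?f = bernoulli_poly m (padic_to_complex x)"
    unfolding volkenborn_integral_def using L by (rule limI)
  ultimately show ?thesis
    \<comment> \<open>With the integral replaced by B_m(x), both (-1)^m B_m(x) and the Daehee sum
      fold back to B_m(1-x), which makes every equation trivial.\<close>
    by (simp only: flip: bernoulli_poly_reflect bernoulli_poly_daehee2_Stirling)
qed

end
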